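(* If an incidence theorem with some matrix has a sphere-tiling proof, then it is true over any skew field.
   Context: Setting. Let $\mathbb{F}$ be a skew field (a division ring). The left projective plane $P^2$ over $\mathbb{F}$ consists of one-dimensional left subspaces $\{(tx,ty,tz):t\in\mathbb{F}\}$ of $\mathbb{F}^3$. Lines are the sets $\{(x,y,z):xa+yb+zc=0\}$ for $(a,b,c)\ne0$. An incidence theorem with an $m\times n$ matrix $M$ (entries $\pm1,0$) asserts that $P_1\in L_1$ for all points $P_1,\dots,P_m$ and lines $L_1,\dots,L_n$ with $M_{ij}=1\Rightarrow P_i\in L_j$ and $M_{ij}=-1\Rightarrow P_i\notin L_j$. An elementary surface-tiling proof is a triangulated closed orientable surface with vertex/edge/face sets $V,E,F$ and maps $p\colon V\sqcup E\to\{1,\dots,m\}$, $l\colon F\sqcup E\to\{1,\dots,n\}$ satisfying three conditions: (0) there is a unique pair (edge $i$, face $j$) with $i\subset j$ and $p(i)=l(j)=1$; (+1) for every other pair with $i\subset j$, where either $i$ is an edge and $j$ a face, or $i\in V\sqcup E$ and $j$ an edge, we have $M_{p(i)l(j)}=1$; (−1) for $i\in V\sqcup E$ and an edge $j$ lying in a common face with $i\not\subset j$, we have $M_{p(i)l(j)}=-1$. A surface-tiling proof also allows auxiliary constructions (appending rows or columns with two $1$'s and the rest $0$, or all $-1$), case distinction, and proof by contradiction. A sphere-tiling proof is a surface-tiling proof in which all the surfaces are spheres. *)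

theory Defs
  imports "HOL-Analysis.Analysis" "Jordan_Normal_Form.Matrix" "HOL-Combinatorics.Transposition"
begin

section \<open>The left projective plane over a skew field\<close>

definition proj_point :: "'a::division_ring \<Rightarrow> 'a \<Rightarrow> 'a \<Rightarrow> ('a \<times> 'a \<times> 'a) set" where
  "proj_point x y z = {(t * x, t * y, t * z) | t. True}"

definition proj_plane :: "('a::division_ring \<times> 'a \<times> 'a) set set" where
  "proj_plane = {proj_point x y z | x y z. (x, y, z) \<noteq> (0, 0, 0)}"

text \<open>A line is represented by the set of all projective points contained in the left subspace
  \<open>x a + y b + z c = 0\<close>, so that incidence is membership.\<close>

definition proj_line ::
    "'a::division_ring \<Rightarrow> 'a \<Rightarrow> 'a \<Rightarrow> ('a \<times> 'a \<times> 'a) set set" where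
  "proj_line a b c = {P \<in> proj_plane. P \<subseteq> {(x, y, z). x * a + y * b + z * c = 0}}"

definition proj_lines :: "('a::division_ring \<times> 'a \<times> 'a) set set set" where
  "proj_lines = {proj_line a b c | a b c. (a, b, c) \<noteq> (0, 0, 0)}"


section \<open>Incidence theorems\<close>

text \<open>Rows stand for points and columns for lines. Matrix indices start at \<open>0\<close>, so the conclusion
  \<open>P\<^sub>1 \<in> L\<^sub>1\<close> belongs to the entry \<open>(0, 0)\<close>, on whose value no condition is imposed.\<close>

definition incidence_matrix :: "int mat \<Rightarrow> bool" where
  "incidence_matrix M \<longleftrightarrow>
     0 < dim_row M \<and> 0 < dim_col M \<and>
     (\<forall>i < dim_row M. \<forall>j < dim_col M. M $$ (i, j) \<in> {1, -1, 0})"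

definition incidence_theorem_true_over :: "'a::division_ring itself \<Rightarrow> int mat \<Rightarrow> bool" where
  "incidence_theorem_true_over _ M \<longleftrightarrow>
     (\<forall>(P :: nat \<Rightarrow> ('a \<times> 'a \<times> 'a) set) (L :: nat \<Rightarrow> ('a \<times> 'a \<times> 'a) set set).
        (\<forall>i < dim_row M. P i \<in> proj_plane) \<longrightarrow>
        (\<forall>j < dim_col M. L j \<in> proj_lines) \<longrightarrow>
        (\<forall>i < dim_row M. \<forall>j < dim_col M.
           (M $$ (i, j) = 1 \<longrightarrow> P i \<in> L j) \<and> (M $$ (i, j) = -1 \<longrightarrow> P i \<notin> L j)) \<longrightarrow>
        P 0 \<in> L 0)"


section \<open>Triangulated surfaces\<close>

text \<open>The cells are closed: a vertex is a singleton, an edge is an arc, a face is a homeomorphic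
  copy of a plane triangle carrying the vertices and sides of the triangle to three distinct vertices
  and three distinct edges. Two faces meet in a union of common edges and vertices; this union need
  not be a single cell, so that besides (homeomorphic images of) simplicial complexes, also
  triangulations with multiple edges are covered.\<close>

definition triangulation_of ::
    "'a::euclidean_space set \<Rightarrow> 'a set set \<Rightarrow> 'a set set \<Rightarrow> 'a set set \<Rightarrow> bool" where
  "triangulation_of S V E F \<longleftrightarrow>
     finite F \<and> \<Union>F = S \<and>
     (\<forall>c \<in> V \<union> E. \<exists>f \<in> F. c \<subseteq> f) \<and>
     (\<forall>f \<in> F. \<exists>(T :: (real^2) set) h k.
        2 simplex T \<and> homeomorphism T f h k \<and>
        {v \<in> V. v \<subseteq> f} = (`) h ` {K. K face_of T \<and> aff_dim K = 0} \<and>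
        {e \<in> E. e \<subseteq> f} = (`) h ` {K. K face_of T \<and> aff_dim K = 1}) \<and>
     (\<forall>f \<in> F. \<forall>g \<in> F. f \<noteq> g \<longrightarrow> f \<inter> g = \<Union>{c \<in> V \<union> E. c \<subseteq> f \<and> c \<subseteq> g})"


section \<open>Tiling proofs\<close>

text \<open>Since vertices, edges and faces are different sets, the maps \<open>p\<close> and \<open>l\<close> on the disjoint unions
  are functions of the cell.\<close>

definition elementary_tiling_proof :: "'a::euclidean_space set \<Rightarrow> int mat \<Rightarrow> bool" where
  "elementary_tiling_proof S M \<longleftrightarrow>
     (\<exists>V E F p l.
        triangulation_of S V E F \<and>
        p ` (V \<union> E) \<subseteq> {..<dim_row M} \<and> l ` (F \<union> E) \<subseteq> {..<dim_col M} \<and>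
        (\<exists>!(i, j). i \<in> E \<and> j \<in> F \<and> i \<subseteq> j \<and> p i = 0 \<and> l j = 0) \<and>
        (\<forall>i \<in> E. \<forall>j \<in> F. i \<subseteq> j \<and> \<not> (p i = 0 \<and> l j = 0) \<longrightarrow> M $$ (p i, l j) = 1) \<and>
        (\<forall>i \<in> V \<union> E. \<forall>j \<in> E. i \<subseteq> j \<longrightarrow> M $$ (p i, l j) = 1) \<and>
        (\<forall>i \<in> V \<union> E. \<forall>j \<in> E. (\<exists>f \<in> F. i \<subseteq> f \<and> j \<subseteq> f) \<and> \<not> i \<subseteq> j \<longrightarrow> M $$ (p i, l j) = -1))"

definition append_row :: "'a mat \<Rightarrow> (nat \<Rightarrow> 'a) \<Rightarrow> 'a mat" where
  "append_row M r = Matrix.mat (dim_row M + 1) (dim_col M)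
     (\<lambda>(a, b). if a < dim_row M then M $$ (a, b) else r b)"

definition append_col :: "'a mat \<Rightarrow> (nat \<Rightarrow> 'a) \<Rightarrow> 'a mat" where
  "append_col M c = Matrix.mat (dim_row M) (dim_col M + 1)
     (\<lambda>(a, b). if b < dim_col M then M $$ (a, b) else c a)"

definition set_entry :: "'a mat \<Rightarrow> nat \<Rightarrow> nat \<Rightarrow> 'a \<Rightarrow> 'a mat" where
  "set_entry M i j x = Matrix.mat (dim_row M) (dim_col M)
     (\<lambda>(a, b). if a = i \<and> b = j then x else M $$ (a, b))"

text \<open>Exchange the first row with row \<open>i\<close> and the first column with column \<open>j\<close>, so that the
  conclusion becomes the incidence of the \<open>i\<close>-th point and the \<open>j\<close>-th line.\<close>

definition move_conclusion :: "'a mat \<Rightarrow> nat \<Rightarrow> nat \<Rightarrow> 'a mat" where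
  "move_conclusion M i j = Matrix.mat (dim_row M) (dim_col M)
     (\<lambda>(a, b). M $$ (Transposition.transpose 0 i a, Transposition.transpose 0 j b))"

text \<open>The parameter is the class of admissible surfaces; every closed orientable surface embeds into
  3-space. In a proof by contradiction, \<open>P\<^sub>1 \<notin> L\<^sub>1\<close> is added to the hypotheses, and some incidence is
  derived that is among those assumed to fail (possibly \<open>P\<^sub>1 \<in> L\<^sub>1\<close> itself).\<close>

inductive tiling_proof :: "(real^3) set set \<Rightarrow> int mat \<Rightarrow> bool" for \<S> where
  elementary:
    "S \<in> \<S> \<Longrightarrow> elementary_tiling_proof S M \<Longrightarrow> tiling_proof \<S> M"
| intersection_point:
    "j < dim_col M \<Longrightarrow> k < dim_col M \<Longrightarrow> j \<noteq> k \<Longrightarrow>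
     tiling_proof \<S> (append_row M (\<lambda>b. if b = j \<or> b = k then 1 else 0)) \<Longrightarrow> tiling_proof \<S> M"
| joining_line:
    "i < dim_row M \<Longrightarrow> k < dim_row M \<Longrightarrow> i \<noteq> k \<Longrightarrow>
     tiling_proof \<S> (append_col M (\<lambda>a. if a = i \<or> a = k then 1 else 0)) \<Longrightarrow> tiling_proof \<S> M"
| generic_point:
    "tiling_proof \<S> (append_row M (\<lambda>b. -1)) \<Longrightarrow> tiling_proof \<S> M"
| generic_line:
    "tiling_proof \<S> (append_col M (\<lambda>a. -1)) \<Longrightarrow> tiling_proof \<S> M"
| case_distinction:
    "i < dim_row M \<Longrightarrow> j < dim_col M \<Longrightarrow> M $$ (i, j) = 0 \<Longrightarrow>
     tiling_proof \<S> (set_entry M i j 1) \<Longrightarrow> tiling_proof \<S> (set_entry M i j (-1)) \<Longrightarrow>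
     tiling_proof \<S> M"
| contradiction:
    "i < dim_row M \<Longrightarrow> j < dim_col M \<Longrightarrow> set_entry M 0 0 (-1) $$ (i, j) = -1 \<Longrightarrow>
     tiling_proof \<S> (move_conclusion (set_entry M 0 0 (-1)) i j) \<Longrightarrow> tiling_proof \<S> M"

definition sphere_tiling_proof :: "int mat \<Rightarrow> bool" where
  "sphere_tiling_proof M \<longleftrightarrow>
     tiling_proof {S. S homeomorphic sphere (0 :: real^3) 1} M"

end

theory Submission
  imports Defs "HOL-Computational_Algebra.Formal_Laurent_Series"
begin

text \<open>Replacing the skew field by its Laurent series in a central variable makes it infinite, so that
  generic points and lines exist; incidences between the old points and lines do not change. All rules
  but the elementary one are then immediate.

  In an elementary proof choose vectors \<open>u x\<close> for the vertices and functionals for the faces. The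
  point of an edge \<open>x y\<close> is \<open>s u x + t u y\<close> with \<open>s, t \<noteq> 0\<close>, and it lies on the line of a face \<open>f\<close> with
  functional \<open>\<phi>\<close> iff \<open>s \<phi>(u x) + t \<phi>(u y) = 0\<close>. So each face other than the exceptional face \<open>f\<^sub>0\<close> gives a
  nonvanishing solution of the equations of its three edges, unique up to a right factor. On the sphere
  minus an interior point of \<open>f\<^sub>0\<close>, which is a plane and retracts onto the other faces, these solutions form
  a local system without monodromy, hence they patch to one solution \<open>G\<close> on all vertices. On \<open>f\<^sub>0\<close> two of the
  equations make \<open>\<phi>\<close> a right multiple of \<open>G\<close>, and the third gives the missing incidence.\<close>

subsection \<open>Linear algebra over a skew field\<close>

text \<open>The disjunction for \<open>m\<close> covers left and right linear systems at once.\<close>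

lemma homogeneous_system:
  fixes m :: "'a::division_ring \<Rightarrow> 'a \<Rightarrow> 'a"
  assumes m: "m = (*) \<or> m = (\<lambda>x y. y * x)"
    and "finite I" "n < card I"
  shows "\<exists>x. (\<exists>i\<in>I. x i \<noteq> 0) \<and> (\<forall>j<n. (\<Sum>i\<in>I. m (x i) (c i j)) = 0)"
  using assms(2,3)
proof (induction n arbitrary: I c)
  case 0
  then show ?case
    by (intro exI[of _ "\<lambda>_. 1"]) (auto simp: card_gt_0_iff)
next
  case (Suc n)
  have assoc: "m (m x y) z = m x (m y z)" for x y z
    using m by (auto simp: mult.assoc)
  have diff: "m x (y - z) = m x y - m x z" for x y z
    using m by (auto simp: algebra_simps)
  have neg: "m (- x) z = - m x z" for x z
    using m by auto
  have sum: "(\<Sum>i\<in>J. m (y i) z) = m (\<Sum>i\<in>J. y i) z" for J :: "'b set" and y z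
    using m by (auto simp: sum_distrib_left sum_distrib_right)
  have inv: "m (inverse x) x = 1" if "x \<noteq> 0" for x
    using m that by auto
  have one: "m x 1 = x" for x
    using m by auto
  show ?case
  proof (cases "\<forall>i\<in>I. c i n = 0")
    case True
    obtain x where "\<exists>i\<in>I. x i \<noteq> 0" "\<forall>j<n. (\<Sum>i\<in>I. m (x i) (c i j)) = 0"
      using Suc.IH[of I c] Suc.prems by auto
    moreover have "(\<Sum>i\<in>I. m (x i) (c i n)) = 0"
      using m True by (intro sum.neutral) auto
    ultimately show ?thesis
      by (metis less_SucE)
  next
    case False
    then obtain k where k: "k \<in> I" "c k n \<noteq> 0" by blast
    \<comment> \<open>Gaussian elimination with pivot \<open>c k n\<close>: subtracting multiples of
      row \<open>k\<close> from the other rows clears column \<open>n\<close>. The unknown with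
      index \<open>k\<close> is then determined by the others, which defines
      \<open>y\<close>.\<close>
    define d where "d i = m (c i n) (inverse (c k n))" for i
    define c' where "c' i j = c i j - m (d i) (c k j)" for i j
    have "n < card (I - {k})"
      using Suc.prems k by simp
    then obtain x where x: "\<exists>i\<in>I - {k}. x i \<noteq> 0" "\<forall>j<n. (\<Sum>i\<in>I - {k}. m (x i) (c' i j)) = 0"
      using Suc.IH[of "I - {k}" c'] Suc.prems by auto
    define y where "y = x(k := - (\<Sum>i\<in>I - {k}. m (x i) (d i)))"
    have eq: "(\<Sum>i\<in>I. m (y i) (c i j)) = (\<Sum>i\<in>I - {k}. m (x i) (c' i j))" for j
    proof -
      have "(\<Sum>i\<in>I. m (y i) (c i j)) = m (y k) (c k j) + (\<Sum>i\<in>I - {k}. m (x i) (c i j))"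
        unfolding sum.remove[OF Suc.prems(1) k(1)] by (auto simp: y_def intro!: sum.cong)
      also have "m (y k) (c k j) = - (\<Sum>i\<in>I - {k}. m (x i) (m (d i) (c k j)))"
        by (simp add: y_def neg sum assoc[symmetric])
      finally show ?thesis
        by (simp add: c'_def diff sum_subtractf)
    qed
    have "c' i n = 0" for i
      using inv[OF k(2)] by (simp add: c'_def d_def assoc one)
    moreover have "m z 0 = 0" for z
      using m by auto
    ultimately have "\<forall>j<Suc n. (\<Sum>i\<in>I. m (y i) (c i j)) = 0"
      unfolding eq using x(2) by (auto simp: less_Suc_eq)
    moreover have "\<exists>i\<in>I. y i \<noteq> 0"
      using x(1) by (auto simp: y_def)
    ultimately show ?thesis by blast
  qed
qed

text \<open>Scalars act on points from the left and on lines from the right. The pairing is linear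
  on the matching sides, so incidence does not depend on the chosen multiples.\<close>

fun pairing :: "'a::division_ring \<times> 'a \<times> 'a \<Rightarrow> 'a \<times> 'a \<times> 'a \<Rightarrow> 'a" where
  "pairing (x, y, z) (a, b, c) = x * a + y * b + z * c"

fun lscale :: "'a::division_ring \<Rightarrow> 'a \<times> 'a \<times> 'a \<Rightarrow> 'a \<times> 'a \<times> 'a" where
  "lscale t (x, y, z) = (t * x, t * y, t * z)"

lemma pairing_add [simp]: "pairing (u + v) w = pairing u w + pairing v w"
  by (cases u; cases v; cases w) (simp add: algebra_simps)

lemma pairing_lscale [simp]: "pairing (lscale t u) w = t * pairing u w"
  by (cases u; cases w) (simp add: algebra_simps)

lemma pairing_zero_left [simp]: "pairing 0 w = 0"
  by (cases w) (simp add: zero_prod_def)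

lemma pairing_eq_0_all:
  assumes "\<And>u. pairing u w = 0"
  shows "w = 0"
  using assms[of "(1, 0, 0)"] assms[of "(0, 1, 0)"] assms[of "(0, 0, 1)"]
  by (cases w) (simp add: zero_prod_def)

text \<open>Two homogeneous equations in three unknowns, with the unknowns to the left of the
  coefficients. This supplies the auxiliary intersection point.\<close>

lemma common_point:
  fixes v w :: "'a::division_ring \<times> 'a \<times> 'a"
  obtains u where "u \<noteq> 0" "pairing u v = 0" "pairing u w = 0"
proof -
  obtain a b c a' b' c' where vw: "v = (a, b, c)" "w = (a', b', c')"
    by (metis prod.collapse)
  obtain x where x: "\<exists>i\<in>{..<3}. x i \<noteq> 0"
    "\<forall>j<2. (\<Sum>i\<in>{..<3}. x i * ([[a, a'], [b, b'], [c, c']] ! i ! j)) = 0"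
    using homogeneous_system[of "(*)" "{..<3::nat}" 2 "\<lambda>i j. [[a, a'], [b, b'], [c, c']] ! i ! j"]
    by auto
  have "x 0 * a + x 1 * b + x 2 * c = 0" "x 0 * a' + x 1 * b' + x 2 * c' = 0"
    using x(2)[rule_format, of 0] x(2)[rule_format, of 1] by (simp_all add: numeral_eq_Suc)
  moreover have "x 0 \<noteq> 0 \<or> x 1 \<noteq> 0 \<or> x 2 \<noteq> 0"
    using x(1) by (auto simp: numeral_eq_Suc less_Suc_eq)
  ultimately show ?thesis
    using that[of "(x 0, x 1, x 2)"] vw by (auto simp: zero_prod_def)
qed

text \<open>Dual to \<open>common_point\<close>, with the unknowns to the right of the
  coefficients.\<close>

lemma common_line:
  fixes v w :: "'a::division_ring \<times> 'a \<times> 'a"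
  obtains u where "u \<noteq> 0" "pairing v u = 0" "pairing w u = 0"
proof -
  obtain a b c a' b' c' where vw: "v = (a, b, c)" "w = (a', b', c')"
    by (metis prod.collapse)
  obtain x where x: "\<exists>i\<in>{..<3}. x i \<noteq> 0"
    "\<forall>j<2. (\<Sum>i\<in>{..<3}. ([[a, a'], [b, b'], [c, c']] ! i ! j) * x i) = 0"
    using homogeneous_system[of "\<lambda>x y. y * x" "{..<3::nat}" 2 "\<lambda>i j. [[a, a'], [b, b'], [c, c']] ! i ! j"]
    by auto
  have "a * x 0 + b * x 1 + c * x 2 = 0" "a' * x 0 + b' * x 1 + c' * x 2 = 0"
    using x(2)[rule_format, of 0] x(2)[rule_format, of 1] by (simp_all add: numeral_eq_Suc)
  moreover have "x 0 \<noteq> 0 \<or> x 1 \<noteq> 0 \<or> x 2 \<noteq> 0"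
    using x(1) by (auto simp: numeral_eq_Suc less_Suc_eq)
  ultimately show ?thesis
    using that[of "(x 0, x 1, x 2)"] vw by (auto simp: zero_prod_def)
qed

text \<open>Four vectors with three coordinates are linearly dependent. The functionals, dual to the
  three vectors up to scalars, prevent a relation among \<open>A\<close>, \<open>B\<close>,
  \<open>C\<close> alone, so the relation can be solved for \<open>W\<close>.\<close>

lemma dual_basis_span:
  assumes "pairing A \<alpha> \<noteq> 0" "pairing B \<alpha> = 0" "pairing C \<alpha> = 0"
    and "pairing A \<beta> = 0" "pairing B \<beta> \<noteq> 0" "pairing C \<beta> = 0"
    and "pairing A \<gamma> = 0" "pairing B \<gamma> = 0" "pairing C \<gamma> \<noteq> 0"
  obtains x y z where "W = lscale x A + lscale y B + lscale z C"
proof -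
  obtain a1 a2 a3 b1 b2 b3 c1 c2 c3 w1 w2 w3 where
    v: "A = (a1, a2, a3)" "B = (b1, b2, b3)" "C = (c1, c2, c3)" "W = (w1, w2, w3)"
    by (metis prod.collapse)
  let ?c = "\<lambda>i j. [[a1, a2, a3], [b1, b2, b3], [c1, c2, c3], [w1, w2, w3]] ! i ! j"
  obtain x where x: "\<exists>i\<in>{..<4}. x i \<noteq> 0" "\<forall>j<3. (\<Sum>i\<in>{..<4}. x i * ?c i j) = 0"
    using homogeneous_system[of "(*)" "{..<4::nat}" 3 ?c] by auto
  have rel: "lscale (x 0) A + lscale (x 1) B + lscale (x 2) C + lscale (x 3) W = 0"
    using x(2)[rule_format, of 0] x(2)[rule_format, of 1] x(2)[rule_format, of 2]
    by (simp add: numeral_eq_Suc v zero_prod_def)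
  \<comment> \<open>Pairing a relation without \<open>W\<close> with each functional isolates one
    coefficient, so all of them would vanish.\<close>
  have "x 3 \<noteq> 0"
  proof
    assume 0: "x 3 = 0"
    have "pairing (lscale (x 0) A + lscale (x 1) B + lscale (x 2) C + lscale (x 3) W) \<delta> = 0" for \<delta>
      unfolding rel by simp
    from this[of \<alpha>] this[of \<beta>] this[of \<gamma>] have "x 0 = 0" "x 1 = 0" "x 2 = 0"
      using assms 0 by auto
    with x(1) 0 show False
      by (auto simp: numeral_eq_Suc less_Suc_eq)
  qed
  then have n: "inverse (x 3) * (x 3 * w) = w" for w
    by (simp flip: mult.assoc)
  have solve: "w = - (inverse (x 3) * x 0) * a + - (inverse (x 3) * x 1) * b + - (inverse (x 3) * x 2) * c"
    if "x 0 * a + x 1 * b + x 2 * c + x 3 * w = 0" for a b c w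
  proof -
    have "x 3 * w = - (x 0 * a + x 1 * b + x 2 * c)"
      using minus_unique[OF that] by simp
    then have "w = inverse (x 3) * - (x 0 * a + x 1 * b + x 2 * c)"
      using n[of w] by metis
    then show ?thesis by (simp add: algebra_simps)
  qed
  have "W = lscale (- (inverse (x 3) * x 0)) A + lscale (- (inverse (x 3) * x 1)) B
      + lscale (- (inverse (x 3) * x 2)) C"
    using rel solve by (simp add: v zero_prod_def)
  then show ?thesis by (rule that)
qed

text \<open>For a face with corners \<open>A\<close>, \<open>B\<close>, \<open>C\<close>, the
  functionals are the lines of the opposite edges, and \<open>X\<close> is the point of the edge
  from \<open>A\<close> to \<open>B\<close>. Pairing \<open>X\<close> with \<gamma> removes the
  \<open>C\<close> component; the other two pairings show that the remaining coefficients are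
  nonzero.\<close>

lemma point_on_side:
  assumes "pairing A \<alpha> \<noteq> 0" "pairing B \<alpha> = 0" "pairing C \<alpha> = 0"
    and "pairing A \<beta> = 0" "pairing B \<beta> \<noteq> 0" "pairing C \<beta> = 0"
    and "pairing A \<gamma> = 0" "pairing B \<gamma> = 0" "pairing C \<gamma> \<noteq> 0"
    and X: "pairing X \<alpha> \<noteq> 0" "pairing X \<beta> \<noteq> 0" "pairing X \<gamma> = 0"
  obtains s t where "s \<noteq> 0" "t \<noteq> 0" "X = lscale s A + lscale t B"
proof -
  obtain x y z where W: "X = lscale x A + lscale y B + lscale z C"
    using dual_basis_span assms(1-9) by blast
  have "z = 0"
    using X(3) assms unfolding W by simp
  moreover have "lscale 0 C = 0"
    by (cases C) (simp add: zero_prod_def)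
  ultimately have "X = lscale x A + lscale y B"
    using W by simp
  moreover have "x \<noteq> 0" "y \<noteq> 0"
    using X(1,2) assms unfolding W by auto
  ultimately show ?thesis using that by blast
qed

subsection \<open>Soundness of the proof rules\<close>

fun point_of :: "'a::division_ring \<times> 'a \<times> 'a \<Rightarrow> ('a \<times> 'a \<times> 'a) set" where
  "point_of (x, y, z) = proj_point x y z"

fun line_of :: "'a::division_ring \<times> 'a \<times> 'a \<Rightarrow> ('a \<times> 'a \<times> 'a) set set" where
  "line_of (a, b, c) = proj_line a b c"

lemma proj_plane_eq: "proj_plane = point_of ` (- {0})"
  unfolding proj_plane_def by (force simp: zero_prod_def image_iff)

lemma proj_lines_eq: "proj_lines = line_of ` (- {0})"
  unfolding proj_lines_def by (force simp: zero_prod_def image_iff)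

text \<open>A one-dimensional left subspace satisfies a linear equation iff its generator, the
  multiple with factor 1, does.\<close>

lemma point_of_in_line_of:
  assumes "u \<noteq> 0"
  shows "point_of u \<in> line_of w \<longleftrightarrow> pairing u w = 0"
proof -
  obtain x y z a b c where uw: "u = (x, y, z)" "w = (a, b, c)"
    by (metis prod.collapse)
  have plane: "point_of u \<in> proj_plane"
    using assms by (auto simp: proj_plane_eq)
  have scale: "t * x * a + t * y * b + t * z * c = t * pairing u w" for t
    by (simp add: uw algebra_simps)
  have "point_of u \<in> line_of w \<longleftrightarrow> (\<forall>t. t * x * a + t * y * b + t * z * c = 0)"
    using plane unfolding uw by (auto simp: proj_line_def proj_point_def)
  also have "\<dots> \<longleftrightarrow> (\<forall>t. t * pairing u w = 0)"
    unfolding scale ..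
  also have "\<dots> \<longleftrightarrow> pairing u w = 0"
    by (metis mult_1 mult_zero_right)
  finally show ?thesis .
qed

text \<open>A configuration satisfying the hypotheses of \<open>M\<close>, in homogeneous
  coordinates. The vectors are constrained only at indices below the dimensions, so a new row or
  column is accommodated by a function update.\<close>

definition realizes ::
    "int mat \<Rightarrow> (nat \<Rightarrow> 'a::division_ring \<times> 'a \<times> 'a) \<Rightarrow> (nat \<Rightarrow> 'a \<times> 'a \<times> 'a) \<Rightarrow> bool" where
  "realizes M u w \<longleftrightarrow>
     (\<forall>i < dim_row M. u i \<noteq> 0) \<and> (\<forall>j < dim_col M. w j \<noteq> 0) \<and>
     (\<forall>i < dim_row M. \<forall>j < dim_col M.
        (M $$ (i, j) = 1 \<longrightarrow> pairing (u i) (w j) = 0) \<and>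
        (M $$ (i, j) = -1 \<longrightarrow> pairing (u i) (w j) \<noteq> 0))"

lemma incidence_theorem_true_over_iff:
  assumes "0 < dim_row M" "0 < dim_col M"
  shows "incidence_theorem_true_over TYPE('a::division_ring) M \<longleftrightarrow>
    (\<forall>(u :: nat \<Rightarrow> 'a \<times> 'a \<times> 'a) w. realizes M u w \<longrightarrow> pairing (u 0) (w 0) = 0)"
proof safe
  fix u w :: "nat \<Rightarrow> 'a \<times> 'a \<times> 'a"
  assume true: "incidence_theorem_true_over TYPE('a) M" and r: "realizes M u w"
  have "point_of (u 0) \<in> line_of (w 0)"
    using r true[unfolded incidence_theorem_true_over_def, rule_format,
        of "\<lambda>i. point_of (u i)" "\<lambda>j. line_of (w j)"]
    by (auto simp: realizes_def proj_plane_eq proj_lines_eq point_of_in_line_of)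
  then show "pairing (u 0) (w 0) = 0"
    using r assms by (simp add: realizes_def point_of_in_line_of)
next
  assume *: "\<forall>(u :: nat \<Rightarrow> 'a \<times> 'a \<times> 'a) w. realizes M u w \<longrightarrow> pairing (u 0) (w 0) = 0"
  show "incidence_theorem_true_over TYPE('a) M"
    unfolding incidence_theorem_true_over_def
  proof (intro allI impI)
    fix P :: "nat \<Rightarrow> ('a \<times> 'a \<times> 'a) set" and L
    assume P: "\<forall>i<dim_row M. P i \<in> proj_plane" and L: "\<forall>j<dim_col M. L j \<in> proj_lines"
      and inc: "\<forall>i<dim_row M. \<forall>j<dim_col M.
        (M $$ (i, j) = 1 \<longrightarrow> P i \<in> L j) \<and> (M $$ (i, j) = - 1 \<longrightarrow> P i \<notin> L j)"
    from P have "\<forall>i. \<exists>v. i < dim_row M \<longrightarrow> v \<noteq> 0 \<and> P i = point_of v"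
      unfolding proj_plane_eq by blast
    then obtain u where u: "\<And>i. i < dim_row M \<Longrightarrow> u i \<noteq> 0 \<and> P i = point_of (u i)"
      by metis
    from L have "\<forall>j. \<exists>v. j < dim_col M \<longrightarrow> v \<noteq> 0 \<and> L j = line_of v"
      unfolding proj_lines_eq by blast
    then obtain w where w: "\<And>j. j < dim_col M \<Longrightarrow> w j \<noteq> 0 \<and> L j = line_of (w j)"
      by metis
    have "realizes M u w"
      using u w inc by (auto simp: realizes_def point_of_in_line_of)
    with * show "P 0 \<in> L 0"
      using u[OF assms(1)] w[OF assms(2)] by (simp add: point_of_in_line_of)
  qed
qed

section \<open>Extension of scalars to an infinite skew field\<close>

lemma infinite_fls: "infinite (UNIV :: 'a::zero_neq_one fls set)"
proof -
  \<comment> \<open>The integer powers of the variable are pairwise distinct.\<close>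
  have "inj (\<lambda>n. fls_X_intpow n :: 'a fls)"
  proof (rule injI)
    fix m n assume "(fls_X_intpow m :: 'a fls) = fls_X_intpow n"
    then have "fls_nth (fls_X_intpow m :: 'a fls) m = fls_nth (fls_X_intpow n) m" by simp
    then show "m = n" by (simp split: if_splits)
  qed
  then show ?thesis
    using infinite_UNIV_int finite_imageD finite_subset subset_UNIV by metis
qed

fun fls_const3 :: "'a::zero \<times> 'a \<times> 'a \<Rightarrow> 'a fls \<times> 'a fls \<times> 'a fls" where
  "fls_const3 (x, y, z) = (fls_const x, fls_const y, fls_const z)"

lemma pairing_fls_const3: "pairing (fls_const3 u) (fls_const3 w) = fls_const (pairing u w)"
  by (cases u; cases w) (simp add: fls_plus_const)

lemma fls_const3_eq_0: "fls_const3 u = 0 \<longleftrightarrow> u = 0"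
  by (cases u) (simp add: zero_prod_def)

lemma realizes_fls_const3:
  "realizes M u w \<Longrightarrow> realizes M (\<lambda>i. fls_const3 (u i)) (\<lambda>j. fls_const3 (w j))"
  by (simp add: realizes_def fls_const3_eq_0 pairing_fls_const3)

section \<open>Points and lines in general position\<close>

lemma exists_avoiding:
  assumes "infinite (UNIV :: 'a set)" "finite I" "\<And>i x y. i \<in> I \<Longrightarrow> R i x \<Longrightarrow> R i y \<Longrightarrow> x = (y::'a)"
  obtains x where "\<And>i. i \<in> I \<Longrightarrow> \<not> R i x"
proof -
  \<comment> \<open>Each condition excludes at most one value, so finitely many of them cannot
    exhaust an infinite type.\<close>
  have "finite {x. R i x}" if "i \<in> I" for i
  proof (cases "\<exists>x. R i x")
    case True
    then obtain x where "R i x" by blast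
    then have "{x. R i x} \<subseteq> {x}" using assms(3)[OF that] by blast
    then show ?thesis using finite_subset by blast
  qed simp
  then have "finite (\<Union>i\<in>I. {x. R i x})" using assms(2) by blast
  then obtain x where "x \<notin> (\<Union>i\<in>I. {x. R i x})"
    using assms(1) ex_new_if_finite by blast
  then show ?thesis using that by blast
qed

lemma affine_root_unique_left:
  fixes a b :: "'a::division_ring"
  shows "a \<noteq> 0 \<or> b \<noteq> 0 \<Longrightarrow> a + x * b = 0 \<Longrightarrow> a + y * b = 0 \<Longrightarrow> x = y"
  by (metis add.right_neutral add_left_cancel mult_cancel_right mult_zero_right)

lemma affine_root_unique_right:
  fixes a b :: "'a::division_ring"
  shows "a \<noteq> 0 \<or> b \<noteq> 0 \<Longrightarrow> a + b * x = 0 \<Longrightarrow> a + b * y = 0 \<Longrightarrow> x = y"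
  by (metis add.right_neutral add_left_cancel mult_cancel_left mult_zero_left)

text \<open>The coordinates of \<open>(1, t, s)\<close> are chosen one after the other. Each line
  excludes at most one value at each stage, because a nontrivial affine expression in one unknown
  has at most one root.\<close>

lemma generic_point_exists:
  fixes w :: "'i \<Rightarrow> 'a::division_ring \<times> 'a \<times> 'a"
  assumes "infinite (UNIV :: 'a set)" "finite J" "\<And>j. j \<in> J \<Longrightarrow> w j \<noteq> 0"
  obtains u where "\<And>j. j \<in> J \<Longrightarrow> pairing u (w j) \<noteq> 0" "u \<noteq> 0"
proof -
  define a b c where "a j = fst (w j)" and "b j = fst (snd (w j))" and "c j = snd (snd (w j))" for j
  have w: "w j = (a j, b j, c j)" for j
    by (simp add: a_def b_def c_def)
  \<comment> \<open>Lines with \<open>a j = b j = 0\<close> do not restrict \<open>t\<close>. They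
    have \<open>c j \<noteq> 0\<close> and are dealt with by the choice of \<open>s\<close>.\<close>
  obtain t where t: "\<And>j. j \<in> J \<Longrightarrow> \<not> ((a j \<noteq> 0 \<or> b j \<noteq> 0) \<and> a j + t * b j = 0)"
    by (rule exists_avoiding[OF assms(1,2), of "\<lambda>j t. (a j \<noteq> 0 \<or> b j \<noteq> 0) \<and> a j + t * b j = 0"])
      (use affine_root_unique_left in blast)+
  obtain s where s: "\<And>j. j \<in> J \<Longrightarrow> \<not> ((a j + t * b j \<noteq> 0 \<or> c j \<noteq> 0) \<and> a j + t * b j + s * c j = 0)"
    by (rule exists_avoiding[OF assms(1,2),
          of "\<lambda>j s. (a j + t * b j \<noteq> 0 \<or> c j \<noteq> 0) \<and> a j + t * b j + s * c j = 0"])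
      (use affine_root_unique_left in blast)+
  show ?thesis
  proof (rule that[of "(1, t, s)"])
    fix j assume "j \<in> J"
    then show "pairing (1, t, s) (w j) \<noteq> 0"
      using t[of j] s[of j] assms(3)[of j] by (auto simp: w zero_prod_def)
  qed (simp add: zero_prod_def)
qed

text \<open>Dual to \<open>generic_point_exists\<close>, with the unknown coordinates on the
  right.\<close>

lemma generic_line_exists:
  fixes u :: "'i \<Rightarrow> 'a::division_ring \<times> 'a \<times> 'a"
  assumes "infinite (UNIV :: 'a set)" "finite J" "\<And>j. j \<in> J \<Longrightarrow> u j \<noteq> 0"
  obtains w where "\<And>j. j \<in> J \<Longrightarrow> pairing (u j) w \<noteq> 0" "w \<noteq> 0"
proof -
  define a b c where "a j = fst (u j)" and "b j = fst (snd (u j))" and "c j = snd (snd (u j))" for j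
  have u: "u j = (a j, b j, c j)" for j
    by (simp add: a_def b_def c_def)
  obtain t where t: "\<And>j. j \<in> J \<Longrightarrow> \<not> ((a j \<noteq> 0 \<or> b j \<noteq> 0) \<and> a j + b j * t = 0)"
    by (rule exists_avoiding[OF assms(1,2), of "\<lambda>j t. (a j \<noteq> 0 \<or> b j \<noteq> 0) \<and> a j + b j * t = 0"])
      (use affine_root_unique_right in blast)+
  obtain s where s: "\<And>j. j \<in> J \<Longrightarrow> \<not> ((a j + b j * t \<noteq> 0 \<or> c j \<noteq> 0) \<and> a j + b j * t + c j * s = 0)"
    by (rule exists_avoiding[OF assms(1,2),
          of "\<lambda>j s. (a j + b j * t \<noteq> 0 \<or> c j \<noteq> 0) \<and> a j + b j * t + c j * s = 0"])
      (use affine_root_unique_right in blast)+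
  show ?thesis
  proof (rule that[of "(1, t, s)"])
    fix j assume "j \<in> J"
    then show "pairing (u j) (1, t, s) \<noteq> 0"
      using t[of j] s[of j] assms(3)[of j] by (auto simp: u zero_prod_def)
  qed (simp add: zero_prod_def)
qed

section \<open>Proof rules acting on configurations\<close>

lemma append_simps [simp]:
  "dim_row (append_row M r) = Suc (dim_row M)" "dim_col (append_row M r) = dim_col M"
  "dim_row (append_col M c) = dim_row M" "dim_col (append_col M c) = Suc (dim_col M)"
  "dim_row (set_entry M i j x) = dim_row M" "dim_col (set_entry M i j x) = dim_col M"
  "dim_row (move_conclusion M i j) = dim_row M" "dim_col (move_conclusion M i j) = dim_col M"
  by (simp_all add: append_row_def append_col_def set_entry_def move_conclusion_def)

lemma realizes_append_row:
  assumes "realizes M u w" "v \<noteq> 0"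
    and "\<And>j. j < dim_col M \<Longrightarrow> r j = 1 \<Longrightarrow> pairing v (w j) = 0"
    and "\<And>j. j < dim_col M \<Longrightarrow> r j = -1 \<Longrightarrow> pairing v (w j) \<noteq> 0"
  shows "realizes (append_row M r) (u(dim_row M := v)) w"
  using assms by (auto simp: realizes_def append_row_def less_Suc_eq)

lemma realizes_append_col:
  assumes "realizes M u w" "v \<noteq> 0"
    and "\<And>i. i < dim_row M \<Longrightarrow> c i = 1 \<Longrightarrow> pairing (u i) v = 0"
    and "\<And>i. i < dim_row M \<Longrightarrow> c i = -1 \<Longrightarrow> pairing (u i) v \<noteq> 0"
  shows "realizes (append_col M c) u (w(dim_col M := v))"
  using assms by (auto simp: realizes_def append_col_def less_Suc_eq)

lemma realizes_set_entry:
  assumes "realizes M u w"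
    and "x = 1 \<Longrightarrow> pairing (u i) (w j) = 0" "x = -1 \<Longrightarrow> pairing (u i) (w j) \<noteq> 0"
  shows "realizes (set_entry M i j x) u w"
  using assms by (auto simp: realizes_def set_entry_def)

lemma realizes_move_conclusion:
  assumes "realizes M u w" "i < dim_row M" "j < dim_col M"
  shows "realizes (move_conclusion M i j)
    (\<lambda>a. u (Transposition.transpose 0 i a)) (\<lambda>b. w (Transposition.transpose 0 j b))"
proof -
  have "Transposition.transpose 0 k a < n" if "a < n" "k < n" for a k n :: nat
    using that by (auto simp: Transposition.transpose_def)
  then show ?thesis
    using assms by (auto simp: realizes_def move_conclusion_def)
qed

text \<open>Induction over the rules, for all configurations at once: auxiliary constructions extend
  the given configuration, and case distinction asks whether the incidence in question holds. The
  geometric content is isolated in \<open>elementary_sound\<close>; infinity of the skew field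
  serves the generic points and lines.\<close>

lemma tiling_proof_sound:
  assumes "infinite (UNIV :: 'a::division_ring set)"
    and elementary_sound: "\<And>S M (u :: nat \<Rightarrow> 'a \<times> 'a \<times> 'a) w. \<lbrakk>S \<in> \<S>; elementary_tiling_proof S M; realizes M u w;
      0 < dim_row M; 0 < dim_col M\<rbrakk> \<Longrightarrow> pairing (u 0) (w 0) = 0"
    and "tiling_proof \<S> M" "realizes M u w" "0 < dim_row M" "0 < dim_col M"
  shows "pairing (u 0) (w 0 :: 'a \<times> 'a \<times> 'a) = 0"
  using assms(3-6)
proof (induction arbitrary: u w)
  case (elementary S M)
  then show ?case using elementary_sound by blast
next
  case (intersection_point j M k)
  obtain v where v: "v \<noteq> 0" "pairing v (w j) = 0" "pairing v (w k) = 0"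
    using common_point by blast
  have "realizes (append_row M (\<lambda>b. if b = j \<or> b = k then 1 else 0)) (u(dim_row M := v)) w"
    using v by (intro realizes_append_row intersection_point.prems) (auto split: if_splits)
  \<comment> \<open>The matrix has at least one row, so the update at index \<open>dim_row M\<close>
    leaves the point with index 0 unchanged.\<close>
  from intersection_point.IH[OF this] show ?case
    using intersection_point.prems by simp
next
  case (joining_line i M k)
  obtain v where v: "v \<noteq> 0" "pairing (u i) v = 0" "pairing (u k) v = 0"
    using common_line by blast
  have "realizes (append_col M (\<lambda>b. if b = i \<or> b = k then 1 else 0)) u (w(dim_col M := v))"
    using v by (intro realizes_append_col joining_line.prems) (auto split: if_splits)
  from joining_line.IH[OF this] show ?case
    using joining_line.prems by simp
next
  case (generic_point M)
  obtain v where v: "\<And>j. j \<in> {..<dim_col M} \<Longrightarrow> pairing v (w j) \<noteq> 0" "v \<noteq> 0"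
    by (rule generic_point_exists[OF assms(1), of "{..<dim_col M}" w])
      (use generic_point.prems in \<open>auto simp: realizes_def\<close>)
  have "realizes (append_row M (\<lambda>b. -1)) (u(dim_row M := v)) w"
    using v by (intro realizes_append_row generic_point.prems) auto
  from generic_point.IH[OF this] show ?case
    using generic_point.prems by simp
next
  case (generic_line M)
  obtain v where v: "\<And>i. i \<in> {..<dim_row M} \<Longrightarrow> pairing (u i) v \<noteq> 0" "v \<noteq> 0"
    by (rule generic_line_exists[OF assms(1), of "{..<dim_row M}" u])
      (use generic_line.prems in \<open>auto simp: realizes_def\<close>)
  have "realizes (append_col M (\<lambda>a. -1)) u (w(dim_col M := v))"
    using v by (intro realizes_append_col generic_line.prems) auto
  from generic_line.IH[OF this] show ?case
    using generic_line.prems by simp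
next
  case (case_distinction i M j)
  then show ?case
    using realizes_set_entry[of M u w 1 i j] realizes_set_entry[of M u w "-1" i j]
    by (cases "pairing (u i) (w j) = 0") auto
next
  case (contradiction i M j)
  show ?case
  proof (rule ccontr)
    assume "pairing (u 0) (w 0) \<noteq> 0"
    \<comment> \<open>With the conclusion failing, the same configuration realizes the strengthened
      matrix. The induction hypothesis then yields an incidence that an entry -1 of this matrix
      forbids.\<close>
    then have r: "realizes (set_entry M 0 0 (-1)) u w"
      using contradiction.prems by (intro realizes_set_entry) auto
    then have "realizes (move_conclusion (set_entry M 0 0 (-1)) i j)
        (\<lambda>a. u (Transposition.transpose 0 i a)) (\<lambda>b. w (Transposition.transpose 0 j b))"
      using contradiction.hyps by (intro realizes_move_conclusion) auto
    from contradiction.IH[OF this] have "pairing (u i) (w j) = 0"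
      using contradiction.prems by simp
    then show False
      using r contradiction.hyps by (auto simp: realizes_def)
  qed
qed

subsection \<open>Local systems on rectangles\<close>

text \<open>A local system of rank one, where \<open>t x y\<close> carries values at
  \<open>y\<close> to values at \<open>x\<close>. Neighbourhoods need not be symmetric, as with open
  stars of a triangulation; the cocycle law is demanded only where all three transports are between
  nearby points.\<close>

locale local_system =
  fixes N :: "'x::t2_space \<Rightarrow> 'x set" and t :: "'x \<Rightarrow> 'x \<Rightarrow> 'g::division_ring"
  assumes open_nbhd: "open (N x)"
    and mem_nbhd: "x \<in> N x"
    and transport_nonzero: "t x y \<noteq> 0"
    and cocycle: "\<lbrakk>y \<in> N x; z \<in> N x; z \<in> N y\<rbrakk> \<Longrightarrow> t x z = t x y * t y z"
begin

text \<open>Flatness at a point of \<open>A\<close> is tested only against nearby points of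
  \<open>A\<close>. Hence sections over closed rectangles make sense and can be pasted along a
  common side.\<close>

definition flat_section :: "'x set \<Rightarrow> ('x \<Rightarrow> 'g) \<Rightarrow> bool" where
  "flat_section A s \<longleftrightarrow>
     (\<forall>x \<in> A. s x \<noteq> 0 \<and> (\<forall>\<^sub>F y in nhds x. y \<in> A \<longrightarrow> s x = t x y * s y))"

lemma eventually_nbhd: "\<forall>\<^sub>F y in nhds x. y \<in> N x"
  using eventually_nhds mem_nbhd open_nbhd by blast

text \<open>This is the transport of the value 1 from \<open>x\<close>. The cocycle law says that it
  is flat.\<close>

lemma flat_section_local:
  assumes "A \<subseteq> N x"
  shows "flat_section A (\<lambda>y. inverse (t x y))"
  unfolding flat_section_def
proof (intro ballI conjI)
  fix y assume y: "y \<in> A"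
  show "inverse (t x y) \<noteq> 0"
    using transport_nonzero by simp
  show "\<forall>\<^sub>F z in nhds y. z \<in> A \<longrightarrow> inverse (t x y) = t y z * inverse (t x z)"
    using eventually_nbhd
  proof eventually_elim
    case (elim z)
    show ?case
    proof
      assume "z \<in> A"
      then have "t x z = t x y * t y z"
        using cocycle elim y assms by blast
      then show "inverse (t x y) = t y z * inverse (t x z)"
        using transport_nonzero by (simp add: nonzero_inverse_mult_distrib flip: mult.assoc)
    qed
  qed
qed

lemma flat_section_mult_right:
  assumes "flat_section A s" "k \<noteq> 0"
  shows "flat_section A (\<lambda>x. s x * k)"
  using assms unfolding flat_section_def
  by (auto elim!: eventually_mono simp: mult.assoc)

text \<open>A point outside a closed set has a neighbourhood disjoint from it, so near every point
  the flatness conditions on \<open>A\<close> and on \<open>B\<close> hold separately, possibly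
  vacuously.\<close>

lemma flat_section_Un:
  assumes "closed A" "closed B" "flat_section A s" "flat_section B s"
  shows "flat_section (A \<union> B) s"
proof -
  have out: "\<forall>\<^sub>F y in nhds x. y \<notin> C" if "closed C" "x \<notin> C" for x and C :: "'x set"
    using that eventually_nhds[of "\<lambda>y. y \<notin> C" x] by (metis ComplD ComplI open_Compl)
  have ev: "\<forall>\<^sub>F y in nhds x. y \<in> C \<longrightarrow> s x = t x y * s y"
    if "closed C" "flat_section C s" for x C
  proof (cases "x \<in> C")
    case True
    then show ?thesis using that(2) by (simp add: flat_section_def)
  next
    case False
    from out[OF that(1) this] show ?thesis by (rule eventually_mono) simp
  qed
  show ?thesis
    unfolding flat_section_def
  proof (intro ballI conjI)
    fix x assume "x \<in> A \<union> B"
    then show "s x \<noteq> 0" using assms(3,4) by (auto simp: flat_section_def)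
    show "\<forall>\<^sub>F y in nhds x. y \<in> A \<union> B \<longrightarrow> s x = t x y * s y"
      using ev[OF assms(1,3), of x] ev[OF assms(2,4), of x] by eventually_elim blast
  qed
qed

text \<open>Two flat sections differ by a locally constant right factor.\<close>

lemma flat_section_glue:
  assumes "closed A" "closed B" "connected (A \<inter> B)" "flat_section A r" "flat_section B s"
  obtains q where "flat_section (A \<union> B) q"
proof -
  have "\<exists>k. k \<noteq> 0 \<and> (\<forall>x \<in> A \<inter> B. r x = s x * k)"
  proof (cases "A \<inter> B = {}")
    case True
    then show ?thesis by (metis empty_iff zero_neq_one)
  next
    case False
    then obtain a where a: "a \<in> A \<inter> B" by blast
    \<comment> \<open>In this quotient the transport \<open>t x y\<close> cancels as a common left
      factor, so \<open>f\<close> is locally constant on the connected overlap.\<close>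
    define f where "f x = inverse (s x) * r x" for x
    have nz: "s x \<noteq> 0" "r x \<noteq> 0" if "x \<in> A \<inter> B" for x
      using that assms(4,5) by (auto simp: flat_section_def)
    have "f a = f b" if "b \<in> A \<inter> B" for b
    proof (rule connected_local_const[OF assms(3) a that], intro ballI)
      fix x assume x: "x \<in> A \<inter> B"
      then have "\<forall>\<^sub>F y in nhds x. y \<in> A \<longrightarrow> r x = t x y * r y"
        "\<forall>\<^sub>F y in nhds x. y \<in> B \<longrightarrow> s x = t x y * s y"
        using assms(4,5) by (auto simp: flat_section_def)
      then have "\<forall>\<^sub>F y in nhds x. y \<noteq> x \<longrightarrow> y \<in> A \<inter> B \<longrightarrow> f x = f y"
      proof eventually_elim
        case (elim y)
        show ?case
        proof (intro impI)
          assume y: "y \<in> A \<inter> B"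
          then have "f x = inverse (t x y * s y) * (t x y * r y)"
            using elim by (simp add: f_def)
          also have "\<dots> = f y"
            using transport_nonzero[of x y] nz[OF y]
            by (simp add: nonzero_inverse_mult_distrib f_def mult.assoc flip: mult.assoc[of "inverse (t x y)"])
          finally show "f x = f y" .
        qed
      qed
      then show "\<forall>\<^sub>F y in at x within A \<inter> B. f x = f y"
        by (simp add: eventually_at_filter)
    qed
    then obtain k where k: "\<And>x. x \<in> A \<inter> B \<Longrightarrow> f x = k"
      by metis
    have "r x = s x * k" if "x \<in> A \<inter> B" for x
      unfolding k[OF that, symmetric] f_def using nz[OF that] by (simp flip: mult.assoc)
    moreover have "k \<noteq> 0"
      using k[OF a] nz[OF a] by (auto simp: f_def)
    ultimately show ?thesis by blast
  qed
  then obtain k where k: "k \<noteq> 0" "\<And>x. x \<in> A \<inter> B \<Longrightarrow> r x = s x * k"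
    by blast
  \<comment> \<open>Right multiplication by \<open>k\<close> keeps \<open>s\<close> flat and makes
    it agree with \<open>r\<close> on the overlap.\<close>
  define q where "q x = (if x \<in> A then r x else s x * k)" for x
  have cong: "flat_section C f" if "flat_section C g" "\<And>x. x \<in> C \<Longrightarrow> f x = g x" for C f g
    using that(1) unfolding flat_section_def by (auto simp: that(2) elim!: eventually_mono)
  have "flat_section A q"
    by (rule cong[OF assms(4)]) (simp add: q_def)
  moreover have "flat_section B q"
    by (rule cong[OF flat_section_mult_right[OF assms(5) k(1)]]) (simp add: q_def k(2))
  ultimately show ?thesis
    using that flat_section_Un assms(1,2) by blast
qed

end

text \<open>Bolzano bisection in each direction: small rectangles lie in one neighbourhood, and
  adjacent rectangles meet in a segment, which is connected, so their sections can be glued.\<close>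

lemma flat_section_rectangle:
  fixes N :: "real \<times> real \<Rightarrow> (real \<times> real) set" and t :: "real \<times> real \<Rightarrow> real \<times> real \<Rightarrow> 'g::division_ring"
  assumes "local_system N t" and "a \<le> b" and "c \<le> d"
  shows "\<exists>s. local_system.flat_section t ({a..b} \<times> {c..d}) s"
proof -
  interpret local_system N t by fact
  note [simp] = closed_Times
  \<comment> \<open>First a strip around height \<open>y\<close> across the whole width. Its
    admissible height may shrink whenever two pieces are joined, hence the minimum below.\<close>
  have strip: "\<exists>e>0. \<forall>c d. c \<le> y \<and> y \<le> d \<and> d - c < e \<longrightarrow> (\<exists>s. flat_section ({a..b} \<times> {c..d}) s)" for y
    using \<open>a \<le> b\<close>
  proof (induction rule: Bolzano)
    case (trans a b a')
    then obtain e e' where e: "e > 0" "\<And>c d. c \<le> y \<Longrightarrow> y \<le> d \<Longrightarrow> d - c < e \<Longrightarrow> \<exists>s. flat_section ({a..b} \<times> {c..d}) s"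
      and e': "e' > 0" "\<And>c d. c \<le> y \<Longrightarrow> y \<le> d \<Longrightarrow> d - c < e' \<Longrightarrow> \<exists>s. flat_section ({b..a'} \<times> {c..d}) s"
      by metis
    have "\<exists>s. flat_section ({a..a'} \<times> {c..d}) s" if cd: "c \<le> y" "y \<le> d" "d - c < min e e'" for c d
    proof -
      obtain r s where rs: "flat_section ({a..b} \<times> {c..d}) r" "flat_section ({b..a'} \<times> {c..d}) s"
        using e(2)[of c d] e'(2)[of c d] cd by auto
      have "({a..b} \<times> {c..d}) \<inter> ({b..a'} \<times> {c..d}) = {b} \<times> {c..d}"
        using trans by auto
      then have "connected (({a..b} \<times> {c..d}) \<inter> ({b..a'} \<times> {c..d}))"
        by (simp add: connected_Times)
      then obtain q where "flat_section (({a..b} \<times> {c..d}) \<union> ({b..a'} \<times> {c..d})) q"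
        using flat_section_glue[OF _ _ _ rs] by auto
      moreover have "({a..b} \<times> {c..d}) \<union> ({b..a'} \<times> {c..d}) = {a..a'} \<times> {c..d}"
        using trans by auto
      ultimately show ?thesis by auto
    qed
    then show ?case
      using e(1) e'(1) by (intro exI[of _ "min e e'"]) auto
  next
    case (local x)
    obtain e where e: "e > 0" "ball (x, y) e \<subseteq> N (x, y)"
      using open_nbhd mem_nbhd open_contains_ball by metis
    \<comment> \<open>Two sides shorter than \<open>e/2\<close> keep every point of the rectangle at
      distance less than \<open>e\<close> from \<open>(x, y)\<close>.\<close>
    have "{a..b} \<times> {c..d} \<subseteq> N (x, y)"
      if "a \<le> x" "x \<le> b" "b - a < e/2" "c \<le> y" "y \<le> d" "d - c < e/2" for a b c d
    proof -
      have "dist (x, y) (x', y') < e" if "x' \<in> {a..b}" "y' \<in> {c..d}" for x' y'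
      proof -
        have "dist (x, y) (x', y') \<le> dist x x' + dist y y'"
          by (metis dist_Pair_Pair sqrt_sum_squares_le_sum zero_le_dist)
        also have "\<dots> < e"
          using that \<open>a \<le> x\<close> \<open>x \<le> b\<close> \<open>b - a < e/2\<close> \<open>c \<le> y\<close> \<open>y \<le> d\<close> \<open>d - c < e/2\<close>
          by (auto simp: dist_real_def)
        finally show ?thesis .
      qed
      then show ?thesis using e(2) by auto
    qed
    then show ?case
      using e(1) flat_section_local by (intro exI[of _ "e/2"]) (metis half_gt_zero)
  qed
  show ?thesis
    using \<open>c \<le> d\<close>
  proof (induction rule: Bolzano)
    case (trans c d d')
    then obtain r s where rs: "flat_section ({a..b} \<times> {c..d}) r" "flat_section ({a..b} \<times> {d..d'}) s"
      by blast
    have "({a..b} \<times> {c..d}) \<inter> ({a..b} \<times> {d..d'}) = {a..b} \<times> {d}"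
      using trans by auto
    then have "connected (({a..b} \<times> {c..d}) \<inter> ({a..b} \<times> {d..d'}))"
      by (simp add: connected_Times)
    then obtain q where "flat_section (({a..b} \<times> {c..d}) \<union> ({a..b} \<times> {d..d'})) q"
      using flat_section_glue[OF _ _ _ rs] by auto
    moreover have "({a..b} \<times> {c..d}) \<union> ({a..b} \<times> {d..d'}) = {a..b} \<times> {c..d'}"
      using trans by auto
    ultimately show ?case by auto
  next
    case (local y)
    then show ?case using strip[of y] by blast
  qed
qed

subsection \<open>Triangulated surfaces\<close>

lemma triangle_faces:
  fixes C :: "'a::euclidean_space set"
  assumes C: "\<not> affine_dependent C" "card C = 3"
  shows "{K. K face_of convex hull C \<and> aff_dim K = 0} = (\<lambda>c. {c}) ` C"
    and "{K. K face_of convex hull C \<and> aff_dim K = 1} = (\<lambda>c. convex hull (C - {c})) ` C"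
proof -
  have fin: "finite C" using C(2) by (simp add: card_ge_0_finite)
  \<comment> \<open>The faces of a simplex are the hulls of subsets of its vertices, and the
    dimension is the number of vertices minus one. So dimensions 0 and 1 mean one and two
    vertices.\<close>
  have dim: "aff_dim (convex hull B) = int (card B) - 1" if "B \<subseteq> C" for B
    using that C(1) affine_independent_iff_card affine_independent_subset
    by (metis aff_dim_convex_hull)
  have faces: "K face_of convex hull C \<longleftrightarrow> (\<exists>B \<subseteq> C. K = convex hull B)" for K
    using face_of_convex_hull_affine_independent[OF C(1)] by blast
  show "{K. K face_of convex hull C \<and> aff_dim K = 0} = (\<lambda>c. {c}) ` C"
  proof (intro equalityI subsetI)
    fix K assume "K \<in> {K. K face_of convex hull C \<and> aff_dim K = 0}"
    then obtain B where "B \<subseteq> C" "K = convex hull B" "card B = 1"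
      using faces dim by auto
    then show "K \<in> (\<lambda>c. {c}) ` C"
      by (auto simp: card_1_singleton_iff)
  next
    fix K assume "K \<in> (\<lambda>c. {c}) ` C"
    then obtain c where "c \<in> C" "K = convex hull {c}" by auto
    then have "{c} \<subseteq> C" "aff_dim K = 0" using dim[of "{c}"] by auto
    then show "K \<in> {K. K face_of convex hull C \<and> aff_dim K = 0}"
      using faces \<open>K = convex hull {c}\<close> by blast
  qed
  show "{K. K face_of convex hull C \<and> aff_dim K = 1} = (\<lambda>c. convex hull (C - {c})) ` C"
  proof (intro equalityI subsetI)
    fix K assume "K \<in> {K. K face_of convex hull C \<and> aff_dim K = 1}"
    then obtain B where B: "B \<subseteq> C" "K = convex hull B" "card B = 2"
      using faces dim by auto
    then have "card (C - B) = 1"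
      using C(2) fin by (simp add: card_Diff_subset finite_subset)
    then obtain c where "C - B = {c}" by (auto simp: card_1_singleton_iff)
    then have "c \<in> C" "B = C - {c}" using B(1) by auto
    then show "K \<in> (\<lambda>c. convex hull (C - {c})) ` C" using B(2) by blast
  next
    fix K assume "K \<in> (\<lambda>c. convex hull (C - {c})) ` C"
    then obtain c where c: "c \<in> C" "K = convex hull (C - {c})" by auto
    then have "card (C - {c}) = 2" using C(2) fin by simp
    then have "C - {c} \<subseteq> C" "aff_dim K = 1" using dim[of "C - {c}"] c by auto
    then show "K \<in> {K. K face_of convex hull C \<and> aff_dim K = 1}"
      using faces c(2) by blast
  qed
qed

text \<open>For an affinely independent set, the hulls of two subsets meet exactly in the hull of
  the intersection.\<close>

lemma triangle_sides_Int:
  fixes C :: "'a::euclidean_space set"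
  assumes "\<not> affine_dependent C" "card C = 3" "a \<in> C" "b \<in> C" "a \<noteq> b"
  obtains c where "c \<in> C" "C = {a, b, c}" "c \<noteq> a" "c \<noteq> b"
    "convex hull (C - {a}) \<inter> convex hull (C - {b}) = {c}"
proof -
  have "card (C - {a, b}) = 1"
    using assms by (simp add: card_Diff_subset card_ge_0_finite)
  then obtain c where c: "C - {a, b} = {c}" by (auto simp: card_1_singleton_iff)
  have "(C - {a}) \<union> (C - {b}) = C" "(C - {a}) \<inter> (C - {b}) = {c}"
    using c assms by auto
  then have "convex hull (C - {a}) \<inter> convex hull (C - {b}) = {c}"
    using convex_hull_Int[of "C - {a}" "C - {b}"] assms(1) by simp
  moreover have "c \<in> C" "C = {a, b, c}" "c \<noteq> a" "c \<noteq> b"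
    using c assms by auto
  ultimately show ?thesis using that by blast
qed

lemma triangle_vertex_in_side:
  fixes C :: "'a::euclidean_space set"
  assumes "\<not> affine_dependent C" "a \<in> C" "b \<in> C"
  shows "a \<in> convex hull (C - {b}) \<longleftrightarrow> a \<noteq> b"
proof
  show "a \<noteq> b" if "a \<in> convex hull (C - {b})"
    using that assms convex_hull_subset_affine_hull unfolding affine_dependent_def by blast
  show "a \<in> convex hull (C - {b})" if "a \<noteq> b"
    using that assms by (simp add: hull_inc)
qed

text \<open>Stereographic projection, transferred through the homeomorphism with the round sphere.
  The plane is a type parameter because both \<open>real^2\<close> and
  \<open>real \<times> real\<close> are used later.\<close>

lemma sphere_punctured_homeomorphic_plane:
  fixes S :: "'a::euclidean_space set"
  assumes "S homeomorphic sphere (0 :: real^3) 1" "x \<in> S" "DIM('b::euclidean_space) = 2"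
  shows "(S - {x}) homeomorphic (UNIV :: 'b set)"
proof -
  obtain f g where fg: "homeomorphism S (sphere (0 :: real^3) 1) f g"
    using assms(1) unfolding homeomorphic_def by blast
  have inj: "inj_on f S"
    by (rule inj_on_inverseI[of _ g]) (rule homeomorphism_apply1[OF fg])
  have "f ` (S - {x}) = sphere 0 1 - {f x}"
    using inj_on_image_set_diff[OF inj, of S "{x}"] assms(2) homeomorphism_image1[OF fg] by simp
  then have "(S - {x}) homeomorphic (sphere (0 :: real^3) 1 - {f x})"
    unfolding homeomorphic_def using homeomorphism_of_subsets[OF fg, of "S - {x}"] by blast
  also have "f x \<in> sphere 0 1"
    using fg assms(2) unfolding homeomorphism_def by blast
  then have "(sphere (0 :: real^3) 1 - {f x}) homeomorphic (UNIV :: 'b set)"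
    using homeomorphic_punctured_sphere_affine[of 1 "f x" 0 "UNIV :: 'b set"] assms(3)
    by simp
  finally show ?thesis .
qed

section \<open>Cells of a triangulation\<close>

locale triangulated =
  fixes S :: "'a::euclidean_space set" and V E F
  assumes tri: "triangulation_of S V E F"
begin

lemmas triangulation_conjuncts = tri[unfolded triangulation_of_def]

lemma finite_faces: "finite F"
  using triangulation_conjuncts[THEN conjunct1] .

lemma Union_faces: "\<Union>F = S"
  using triangulation_conjuncts[THEN conjunct2, THEN conjunct1] .

lemma cell_in_face: "c \<in> V \<union> E \<Longrightarrow> \<exists>f\<in>F. c \<subseteq> f"
  using triangulation_conjuncts[THEN conjunct2, THEN conjunct2, THEN conjunct1] by (rule bspec)

lemma faces_Int:
  "\<lbrakk>f \<in> F; g \<in> F; f \<noteq> g\<rbrakk> \<Longrightarrow> f \<inter> g = \<Union>{c \<in> V \<union> E. c \<subseteq> f \<and> c \<subseteq> g}"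
  using triangulation_conjuncts[THEN conjunct2, THEN conjunct2, THEN conjunct2, THEN conjunct2]
  by (meson bspec)

lemma face_chart:
  assumes "f \<in> F"
  obtains C :: "(real^2) set" and h k where "\<not> affine_dependent C" "card C = 3"
    "homeomorphism (convex hull C) f h k"
    "{v \<in> V. v \<subseteq> f} = (\<lambda>c. {h c}) ` C"
    "{e \<in> E. e \<subseteq> f} = (\<lambda>c. h ` (convex hull (C - {c}))) ` C"
proof -
  obtain T :: "(real^2) set" and h k where T: "2 simplex T" "homeomorphism T f h k"
    "{v \<in> V. v \<subseteq> f} = (`) h ` {K. K face_of T \<and> aff_dim K = 0}"
    "{e \<in> E. e \<subseteq> f} = (`) h ` {K. K face_of T \<and> aff_dim K = 1}"
    using triangulation_conjuncts[THEN conjunct2, THEN conjunct2, THEN conjunct2, THEN conjunct1] assms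
    by meson
  obtain C where C: "\<not> affine_dependent C" "card C = 3" "T = convex hull C"
    using T(1) unfolding simplex_def by auto
  show ?thesis
    using that[of C h k] T C triangle_faces[OF C(1,2)] by (simp add: image_image)
qed

text \<open>The combinatorial part of a face chart: \<open>K\<close> holds the three corners, and
  \<open>op x\<close> is the side opposite \<open>x\<close>. The last clause says that two sides
  opposite different corners meet only in corners.\<close>

definition face_frame :: "'a set \<Rightarrow> 'a set \<Rightarrow> ('a \<Rightarrow> 'a set) \<Rightarrow> bool" where
  "face_frame f K op \<longleftrightarrow> card K = 3 \<and>
     {v \<in> V. v \<subseteq> f} = (\<lambda>x. {x}) ` K \<and> {e \<in> E. e \<subseteq> f} = op ` K \<and>
     (\<forall>x\<in>K. K \<inter> op x = K - {x}) \<and> (\<forall>x\<in>K. \<forall>y\<in>K. x \<noteq> y \<longrightarrow> op x \<inter> op y \<subseteq> K)"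

lemma face_frameD:
  assumes "face_frame f K op"
  shows "card K = 3" "{v \<in> V. v \<subseteq> f} = (\<lambda>x. {x}) ` K" "{e \<in> E. e \<subseteq> f} = op ` K"
    and "\<And>x. x \<in> K \<Longrightarrow> K \<inter> op x = K - {x}"
    and "\<And>x y. \<lbrakk>x \<in> K; y \<in> K; x \<noteq> y\<rbrakk> \<Longrightarrow> op x \<inter> op y \<subseteq> K"
  using assms unfolding face_frame_def by simp_all

lemma face_frame_exists:
  assumes "f \<in> F"
  obtains K op where "face_frame f K op"
proof -
  obtain C :: "(real^2) set" and h k where C: "\<not> affine_dependent C" "card C = 3"
    and hom: "homeomorphism (convex hull C) f h k"
    and V: "{v \<in> V. v \<subseteq> f} = (\<lambda>c. {h c}) ` C"
    and E: "{e \<in> E. e \<subseteq> f} = (\<lambda>c. h ` (convex hull (C - {c}))) ` C"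
    using face_chart[OF assms] by blast
  have k: "k (h z) = z" if "z \<in> convex hull C" for z
    using hom that by (simp add: homeomorphism_apply1)
  have sub: "convex hull (C - {c}) \<subseteq> convex hull C" for c
    by (simp add: hull_mono)
  have incC: "c \<in> convex hull C" if "c \<in> C" for c
    using that by (simp add: hull_inc)
  have injT: "inj_on h (convex hull C)"
    by (rule inj_on_inverseI[of _ k]) (rule k)
  then have inj: "inj_on h C"
    by (rule inj_on_subset) (rule hull_subset)
  \<comment> \<open>Corners now live on the surface; \<open>k\<close> takes them back to the corners
    of the plane triangle.\<close>
  define op where "op x = h ` (convex hull (C - {k x}))" for x
  have "face_frame f (h ` C) op"
    unfolding face_frame_def
  proof (intro conjI ballI impI)
    show "card (h ` C) = 3"
      using C(2) card_image inj by metis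
    show "{v \<in> V. v \<subseteq> f} = (\<lambda>x. {x}) ` h ` C"
      unfolding V by (simp add: image_image)
    show "{e \<in> E. e \<subseteq> f} = op ` h ` C"
      unfolding E image_image op_def using k incC by (intro image_cong) auto
    fix x assume "x \<in> h ` C"
    then obtain a where a: "a \<in> C" "x = h a" by blast
    have *: "h b \<in> op x \<longleftrightarrow> b \<noteq> a" if "b \<in> C" for b
    proof -
      have "h b \<in> op x \<longleftrightarrow> b \<in> convex hull (C - {a})"
        unfolding op_def a(2) k[OF incC[OF a(1)]]
        by (rule inj_on_image_mem_iff[OF injT incC[OF that] sub])
      then show ?thesis
        using triangle_vertex_in_side[OF C(1) that a(1)] by simp
    qed
    show "h ` C \<inter> op x = h ` C - {x}"
      using * a inj by (auto simp: inj_on_eq_iff)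
    fix y assume "y \<in> h ` C" "x \<noteq> y"
    then obtain b where b: "b \<in> C" "y = h b" "a \<noteq> b" using a by blast
    obtain c where c: "c \<in> C" "convex hull (C - {a}) \<inter> convex hull (C - {b}) = {c}"
      using triangle_sides_Int[OF C a(1) b(1,3)] by metis
    have "op x \<inter> op y = h ` (convex hull (C - {a}) \<inter> convex hull (C - {b}))"
      unfolding op_def a(2) b(2) k[OF incC[OF a(1)]] k[OF incC[OF b(1)]]
      by (rule inj_on_image_Int[OF injT sub sub, symmetric])
    then show "op x \<inter> op y \<subseteq> h ` C"
      using c by simp
  qed
  then show ?thesis by (rule that)
qed

lemma vertex_singleton:
  assumes "v \<in> V"
  shows "\<exists>x. v = {x}"
proof -
  obtain f where f: "f \<in> F" "v \<subseteq> f" using cell_in_face assms by blast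
  obtain K op where "face_frame f K op" using face_frame_exists[OF f(1)] .
  from face_frameD(2)[OF this] show ?thesis using assms f by blast
qed

lemma finite_cells: "finite (V \<union> E \<union> F)"
proof -
  have "finite {v \<in> V. v \<subseteq> f}" "finite {e \<in> E. e \<subseteq> f}" if f: "f \<in> F" for f
  proof -
    obtain K op where "face_frame f K op" using face_frame_exists[OF f] .
  note K = face_frameD[OF this]
    then have "finite K" by (simp add: card_ge_0_finite)
    then show "finite {v \<in> V. v \<subseteq> f}" "finite {e \<in> E. e \<subseteq> f}"
      by (simp_all add: K)
  qed
  then have "finite (\<Union>f\<in>F. {v \<in> V. v \<subseteq> f} \<union> {e \<in> E. e \<subseteq> f})"
    using finite_faces by blast
  moreover have "V \<union> E \<subseteq> (\<Union>f\<in>F. {v \<in> V. v \<subseteq> f} \<union> {e \<in> E. e \<subseteq> f})"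
    using cell_in_face by blast
  ultimately show ?thesis
    using finite_faces finite_subset by blast
qed

lemma compact_face: "f \<in> F \<Longrightarrow> compact f" and connected_face: "f \<in> F \<Longrightarrow> connected f"
proof -
  assume "f \<in> F"
  then obtain C :: "(real^2) set" and h k where C: "card C = 3"
    and hom: "homeomorphism (convex hull C) f h k"
    by (rule face_chart)
  have "compact (convex hull C)"
    using C by (simp add: card_ge_0_finite finite_imp_compact_convex_hull)
  moreover have "connected (convex hull C)"
    by (simp add: convex_connected)
  ultimately show "compact f" "connected f"
    using hom by (metis compact_continuous_image homeomorphism_def)
      (metis \<open>connected (convex hull C)\<close> connected_continuous_image hom homeomorphism_def)
qed

lemma compact_cell: "c \<in> V \<union> E \<union> F \<Longrightarrow> compact c"
proof -
  assume "c \<in> V \<union> E \<union> F"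
  moreover have "compact c" if "c \<in> V"
    using vertex_singleton[OF that] by auto
  moreover have "compact c" if e: "c \<in> E"
  proof -
    obtain f where f: "f \<in> F" "c \<subseteq> f" using cell_in_face e by blast
    obtain C :: "(real^2) set" and h k where C: "\<not> affine_dependent C" "card C = 3"
      and hom: "homeomorphism (convex hull C) f h k"
      and "{v \<in> V. v \<subseteq> f} = (\<lambda>c. {h c}) ` C"
      and E: "{e \<in> E. e \<subseteq> f} = (\<lambda>c. h ` (convex hull (C - {c}))) ` C"
      using face_chart[OF f(1)] .
    have "c \<in> {e \<in> E. e \<subseteq> f}" using e f by simp
    then obtain a where a: "c = h ` (convex hull (C - {a}))" unfolding E by (rule imageE)
    have "compact (convex hull (C - {a}))"
      using C(2) by (simp add: card_ge_0_finite finite_imp_compact_convex_hull)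
    moreover have "continuous_on (convex hull (C - {a})) h"
      by (rule continuous_on_subset[OF homeomorphism_cont1[OF hom] hull_mono]) simp
    ultimately show ?thesis unfolding a by (rule compact_continuous_image[rotated])
  qed
  ultimately show ?thesis using compact_face by blast
qed

lemma edges_of_face_Int:
  assumes "f \<in> F" "d \<in> E" "e \<in> E" "d \<subseteq> f" "e \<subseteq> f" "d \<noteq> e" "x \<in> d" "x \<in> e"
  shows "{x} \<in> V"
proof -
  obtain K op where "face_frame f K op" using face_frame_exists[OF assms(1)] .
  note K = face_frameD[OF this]
  have "d \<in> op ` K" "e \<in> op ` K" using K(3) assms by blast+
  then have "x \<in> K" using K(5) assms by blast
  then show ?thesis using K(2) by blast
qed

text \<open>Take a face \<open>f'\<close> around \<open>e\<close>. If it is not \<open>f\<close>,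
  some common cell of \<open>f\<close> and \<open>f'\<close> contains \<open>x\<close>. This cell is
  not a vertex, hence an edge, and it equals \<open>e\<close> because different edges of
  \<open>f'\<close> meet only in vertices.\<close>

lemma edge_subset_face:
  assumes "e \<in> E" "f \<in> F" "x \<in> e" "x \<in> f" "{x} \<notin> V"
  shows "e \<subseteq> f"
proof -
  obtain f' where f': "f' \<in> F" "e \<subseteq> f'" using cell_in_face assms by blast
  show ?thesis
  proof (cases "f' = f")
    case False
    then obtain c where c: "c \<in> V \<union> E" "c \<subseteq> f" "c \<subseteq> f'" "x \<in> c"
      using faces_Int[OF f'(1) assms(2)] f' assms by blast
    then have "c \<in> E" using vertex_singleton assms(5) by blast
    then have "c = e" using edges_of_face_Int[OF f'(1)] c f' assms by blast
    then show ?thesis using c by blast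
  qed (use f' in simp)
qed

lemma edge_unique:
  assumes "d \<in> E" "e \<in> E" "x \<in> d" "x \<in> e" "{x} \<notin> V"
  shows "d = e"
proof -
  obtain f where f: "f \<in> F" "d \<subseteq> f" using cell_in_face assms by blast
  then have "e \<subseteq> f" using edge_subset_face assms by blast
  then show ?thesis using edges_of_face_Int f assms by blast
qed

lemma edge_has_vertex:
  assumes "e \<in> E"
  obtains x where "{x} \<in> V" "x \<in> e"
proof -
  obtain f where f: "f \<in> F" "e \<subseteq> f" using cell_in_face assms by blast
  obtain K op where "face_frame f K op" using face_frame_exists[OF f(1)] .
  note K = face_frameD[OF this]
  obtain x where x: "x \<in> K" "e = op x" using K(3) assms f by blast
  have "card (K - {x}) = 2" using K(1) x by simp
  then have "K - {x} \<noteq> {}" by (metis card.empty zero_neq_numeral)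
  then obtain y where "y \<in> K - {x}" by blast
  then show ?thesis using that[of y] K(2) K(4)[OF x(1)] x by blast
qed

lemma face_has_vertex:
  assumes "f \<in> F"
  obtains x where "{x} \<in> V" "x \<in> f"
proof -
  obtain K op where "face_frame f K op" using face_frame_exists[OF assms] .
  note K = face_frameD[OF this]
  have "K \<noteq> {}" using K(1) by (metis card.empty zero_neq_numeral)
  then obtain x where "x \<in> K" by blast
  then show ?thesis using that[of x] K(2) by blast
qed

text \<open>The vertex \<open>r x\<close> belongs to the smallest cell around \<open>x\<close>; it lets data on vertices define a
  transport between nearby points of the surface.\<close>

lemma carrier_vertex_exists:
  obtains r where "\<And>x c. \<lbrakk>x \<in> c; c \<in> V \<union> E \<union> F\<rbrakk> \<Longrightarrow> {r x} \<in> V \<and> r x \<in> c"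
    and "\<And>x. {x} \<in> V \<Longrightarrow> r x = x"
proof -
  have "\<exists>y. (\<forall>c \<in> V \<union> E \<union> F. x \<in> c \<longrightarrow> {y} \<in> V \<and> y \<in> c) \<and> ({x} \<in> V \<longrightarrow> y = x)" for x
  proof (cases "{x} \<in> V")
    case False
    then have noV: "x \<notin> c" if "c \<in> V" for c
      using vertex_singleton that by blast
    show ?thesis
    proof (cases "\<exists>e \<in> E. x \<in> e")
      case True
      then obtain e where e: "e \<in> E" "x \<in> e" by blast
      obtain y where y: "{y} \<in> V" "y \<in> e" using edge_has_vertex e by blast
      \<comment> \<open>A cell containing \<open>x\<close> is either \<open>e\<close> itself or a
        face around \<open>e\<close>, so any vertex of \<open>e\<close> serves.\<close>
      have "y \<in> c" if "c \<in> V \<union> E \<union> F" "x \<in> c" for c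
        using that noV edge_unique[of c e x] edge_subset_face[of e c x] e y False by blast
      then show ?thesis using y False by blast
    next
      case noE: False
      \<comment> \<open>Two different faces meet only in vertices and edges, so a point on none of
        these lies in at most one face. Outside the surface the claim is vacuous.\<close>
      have unique: "f = f'" if "f \<in> F" "f' \<in> F" "x \<in> f" "x \<in> f'" for f f'
        using faces_Int[of f f'] that noE noV by blast
      show ?thesis
      proof (cases "\<exists>f \<in> F. x \<in> f")
        case True
        then obtain f where f: "f \<in> F" "x \<in> f" by blast
        obtain y where "{y} \<in> V" "y \<in> f" using face_has_vertex f by blast
        then show ?thesis using unique f noE noV False by blast
      qed (use noE noV False in blast)
    qed
  qed blast
  then show ?thesis using that by metis
qed

section \<open>Retraction of the punctured surface onto the other faces\<close>

lemma other_faces_Int: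
  assumes "f0 \<in> F" and C: "\<not> affine_dependent C" "card C = 3"
    and "homeomorphism (convex hull C) f0 h k"
    and "{v \<in> V. v \<subseteq> f0} = (\<lambda>c. {h c}) ` C"
    and "{e \<in> E. e \<subseteq> f0} = (\<lambda>c. h ` (convex hull (C - {c}))) ` C"
  shows "\<Union>(F - {f0}) \<inter> f0 \<subseteq> h ` frontier (convex hull C :: (real^2) set)"
proof
  have fr: "frontier (convex hull C) = \<Union>{convex hull (C - {x}) |x. x \<in> C}"
    using frontier_convex_hull_cases[OF C(1)] C(2) by simp
  fix x assume "x \<in> \<Union>(F - {f0}) \<inter> f0"
  then obtain f where f: "f \<in> F" "f \<noteq> f0" "x \<in> f" "x \<in> f0" by blast
  \<comment> \<open>Different faces meet in common vertices and edges, and those of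
    \<open>f0\<close> lie over the frontier of the triangle.\<close>
  then obtain c where c: "c \<in> V \<union> E" "c \<subseteq> f0" "x \<in> c"
    using faces_Int[OF f(1) assms(1) f(2)] by blast
  show "x \<in> h ` frontier (convex hull C)"
  proof (cases "c \<in> E")
    case True
    then have "c \<in> {e \<in> E. e \<subseteq> f0}" using c by simp
    then obtain a where "a \<in> C" "c = h ` (convex hull (C - {a}))"
      unfolding assms(6) by (rule imageE)
    then show ?thesis using c(3) unfolding fr by blast
  next
    case False
    then have "c \<in> {v \<in> V. v \<subseteq> f0}" using c by simp
    then obtain a where "a \<in> C" "c = {h a}"
      unfolding assms(5) by (rule imageE)
    then have "x = h a" "a \<in> frontier (convex hull C)"
      using c(3) in_frontier_convex_hull[of C a] C(2) by (auto simp: card_ge_0_finite)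
    then show ?thesis by blast
  qed
qed

lemma compact_other_faces: "compact (\<Union>(F - {f0}))"
  using compact_Union[of "F - {f0}"] compact_face finite_faces by simp

text \<open>Otherwise an open part of the surface is a neighbourhood of a boundary point of a triangle,
  against invariance of domain.\<close>

lemma edge_in_other_face:
  assumes "S homeomorphic sphere (0 :: real^3) 1" and f0: "f0 \<in> F" and e: "e \<in> E" "e \<subseteq> f0"
  obtains f where "f \<in> F - {f0}" "e \<subseteq> f"
proof (rule ccontr)
  assume "\<not> thesis"
  with that have no: "\<not> e \<subseteq> f" if "f \<in> F - {f0}" for f
    using that by blast
  obtain C :: "(real^2) set" and h k where C: "\<not> affine_dependent C" "card C = 3"
    and hom: "homeomorphism (convex hull C) f0 h k"
    and V: "{v \<in> V. v \<subseteq> f0} = (\<lambda>c. {h c}) ` C"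
    and E: "{e \<in> E. e \<subseteq> f0} = (\<lambda>c. h ` (convex hull (C - {c}))) ` C"
    using face_chart[OF f0] .
  have "e \<in> {e \<in> E. e \<subseteq> f0}" using e by simp
  then obtain c where c: "c \<in> C" "e = h ` (convex hull (C - {c}))"
    unfolding E by (rule imageE)
  have "card (C - {c}) = 2" using C(2) c(1) by simp
  then obtain a b where ab: "C - {c} = {a, b}" "a \<noteq> b"
    by (auto simp: card_2_iff)
  then have abc: "a \<in> C" "b \<in> C" "a \<noteq> c" "b \<noteq> c" by auto
  \<comment> \<open>A point of the side opposite \<open>c\<close> that lies on neither of the other
    two sides.\<close>
  define m where "m = midpoint a b"
  have m: "m \<in> convex hull (C - {c})" "m \<noteq> a" "m \<noteq> b"
    using ab by (auto simp: m_def segment_convex_hull[symmetric])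
  have sub: "convex hull (C - {x}) \<subseteq> convex hull C" for x
    by (rule hull_mono) blast
  have kh: "k (h z) = z" if "z \<in> convex hull C" for z
    using hom that by (simp add: homeomorphism_apply1)
  have inj: "inj_on h (convex hull C)"
    by (rule inj_on_inverseI[of _ k]) (rule kh)
  have not_side: "m \<notin> convex hull (C - {x})" if x: "x \<in> {a, b}" for x
  proof
    assume mx: "m \<in> convex hull (C - {x})"
    have "x \<in> C" "x \<noteq> c" using x abc by auto
    then obtain d where d: "C = {c, x, d}" "convex hull (C - {c}) \<inter> convex hull (C - {x}) = {d}"
      using triangle_sides_Int[OF C c(1)] by metis
    then have "m = d" using mx m(1) by blast
    moreover have "d \<in> {a, b} \<or> d = c" using d(1) ab(1) by blast
    moreover have "d \<noteq> c"
      using d C(2) by (auto simp: card_insert_if split: if_splits)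
    ultimately show False using m by blast
  qed
  \<comment> \<open>A closed set containing the other faces and the two remaining sides, in
    particular the corner \<open>h a\<close>, but not \<open>h m\<close>. Off \<open>B\<close> only
    points of \<open>f0\<close> remain.\<close>
  define B where "B = \<Union>(F - {f0}) \<union> h ` (convex hull (C - {a})) \<union> h ` (convex hull (C - {b}))"
  have "compact (h ` (convex hull (C - {x})))" for x
    using C(2) continuous_on_subset[OF homeomorphism_cont1[OF hom] sub]
    by (intro compact_continuous_image finite_imp_compact_convex_hull) (auto simp: card_ge_0_finite)
  then have "closed B"
    unfolding B_def using compact_other_faces by (intro closed_Un compact_imp_closed)
  have "h m \<notin> B"
  proof
    assume "h m \<in> B"
    moreover have "h m \<notin> h ` (convex hull (C - {x}))" if "x \<in> {a, b}" for x
      using inj_on_image_mem_iff[OF inj _ sub, of m x] m(1) sub not_side[OF that] by blast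
    ultimately obtain f where f: "f \<in> F" "f \<noteq> f0" "h m \<in> f"
      unfolding B_def by blast
    have mf0: "h m \<in> f0" using m(1) c(2) e(2) by blast
    obtain d where d: "d \<in> V \<union> E" "d \<subseteq> f0" "d \<subseteq> f" "h m \<in> d"
      using faces_Int[OF f(1) f0 f(2)] f(3) mf0 by blast
    show False
    proof (cases "d \<in> E")
      case True
      then have "d \<in> {e \<in> E. e \<subseteq> f0}" using d by simp
      then obtain x where x: "x \<in> C" "d = h ` (convex hull (C - {x}))"
        unfolding E by (rule imageE)
      then have "m \<in> convex hull (C - {x})"
        using inj_on_image_mem_iff[OF inj _ sub, of m x] m(1) sub d(4) by blast
      then have "x = c" using not_side x(1) ab(1) by blast
      then show False using no[of f] f d(3) x(2) c(2) by blast
    next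
      case False
      then have "d \<in> {v \<in> V. v \<subseteq> f0}" using d by simp
      then obtain x where x: "x \<in> C" "d = {h x}"
        unfolding V by (rule imageE)
      then have "m = x"
        using inj d(4) m(1) sub[of c] hull_inc[of x C] by (auto simp: inj_on_eq_iff)
      then have "m = c" using x(1) ab(1) m by blast
      moreover have "c \<notin> convex hull (C - {c})"
        using triangle_vertex_in_side[OF C(1) c(1) c(1)] by simp
      ultimately show False using m(1) by simp
    qed
  qed
  have "h a \<in> B"
    unfolding B_def using triangle_vertex_in_side[OF C(1) abc(1,2)] ab(2) by blast
  have "h a \<in> f0" using homeomorphism_image1[OF hom] abc(1) hull_inc[of a C] by blast
  then have "h a \<in> S" using Union_faces f0 by blast
  \<comment> \<open>Puncturing the sphere at a corner gives plane coordinates \<open>H\<close>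
    around \<open>h m\<close>.\<close>
  then have "(S - {h a}) homeomorphic (UNIV :: (real^2) set)"
    using sphere_punctured_homeomorphic_plane[OF assms(1), where ?'b = "real^2"] by simp
  then obtain H H' where H: "homeomorphism (S - {h a}) (UNIV :: (real^2) set) H H'"
    unfolding homeomorphic_def by blast
  define Q where "Q = (S - {h a}) - B"
  have Qf0: "Q \<subseteq> f0"
    unfolding Q_def B_def using Union_faces by blast
  have Qsub: "Q \<subseteq> S - {h a}" unfolding Q_def by blast
  have "openin (top_of_set (S - {h a})) Q"
    unfolding Q_def using \<open>closed B\<close> by (metis Diff_eq openin_open_Int open_Compl)
  then have openQ: "open (H ` Q)"
    using homeomorphism_imp_open_map[OF H] by simp
  have HQ: "H' ` (H ` Q) = Q"
  proof -
    have "H' (H x) = x" if "x \<in> Q" for x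
      using homeomorphism_apply1[OF H] Qsub that by blast
    then show ?thesis by (simp add: image_image)
  qed
  \<comment> \<open>This map between planes is continuous and injective on an open set, so
    \<open>k\<close> followed by invariance of domain makes the image of \<open>Q\<close> an open
    subset of the triangle. It contains the frontier point \<open>m\<close>, which is
    impossible.\<close>
  have "open ((k \<circ> H') ` (H ` Q))"
  proof (rule invariance_of_domain[OF _ openQ])
    show "continuous_on (H ` Q) (k \<circ> H')"
    proof (rule continuous_on_compose)
      show "continuous_on (H ` Q) H'"
        by (rule continuous_on_subset[OF homeomorphism_cont2[OF H]]) simp
      show "continuous_on (H' ` (H ` Q)) k"
        unfolding HQ by (rule continuous_on_subset[OF homeomorphism_cont2[OF hom] Qf0])
    qed
    have "inj_on H' (H ` Q)"
      by (rule inj_on_inverseI[of _ H]) (simp add: homeomorphism_apply2[OF H])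
    moreover have "inj_on k (H' ` (H ` Q))"
      unfolding HQ by (rule inj_on_inverseI[of _ h]) (use homeomorphism_apply2[OF hom] Qf0 in blast)
    ultimately show "inj_on (k \<circ> H') (H ` Q)"
      by (rule comp_inj_on)
  qed
  then have "open (k ` Q)"
    unfolding image_comp[symmetric] HQ .
  moreover have "k ` Q \<subseteq> convex hull C"
    using Qf0 homeomorphism_image2[OF hom] by blast
  moreover have "m \<in> k ` Q"
  proof -
    have "m \<in> convex hull C" using m(1) sub by blast
    moreover have "h m \<in> S" using m(1) c(2) e(2) Union_faces f0 by blast
    ultimately show ?thesis
      unfolding Q_def using \<open>h m \<notin> B\<close> \<open>h a \<in> B\<close> kh by (metis DiffI image_eqI singletonD)
  qed
  ultimately have "m \<in> interior (convex hull C)"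
    using interior_maximal by blast
  moreover have "m \<in> frontier (convex hull C)"
    using frontier_convex_hull_cases[OF C(1)] C(2) m(1) c(1) by auto
  ultimately show False
    by (simp add: frontier_def)
qed

text \<open>The frontier of a plane triangle is a retract of the plane minus an interior point.
  Transported by the chart of \<open>f0\<close> and extended by the identity on the other faces,
  this gives the retraction, with the puncture at the image of the interior point.\<close>

lemma punctured_retraction:
  assumes sph: "S homeomorphic sphere (0 :: real^3) 1" and f0: "f0 \<in> F"
  obtains x0 r where "x0 \<in> S" "x0 \<notin> \<Union>(F - {f0})" "continuous_on (S - {x0}) r"
    "r ` (S - {x0}) \<subseteq> \<Union>(F - {f0})" "\<And>x. x \<in> \<Union>(F - {f0}) \<Longrightarrow> r x = x"
proof -
  let ?D = "\<Union>(F - {f0})"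
  obtain C :: "(real^2) set" and h k where C: "\<not> affine_dependent C" "card C = 3"
    and hom: "homeomorphism (convex hull C) f0 h k"
    and V: "{v \<in> V. v \<subseteq> f0} = (\<lambda>c. {h c}) ` C"
    and E: "{e \<in> E. e \<subseteq> f0} = (\<lambda>c. h ` (convex hull (C - {c}))) ` C"
    using face_chart[OF f0] .
  let ?T = "convex hull C"
  have kh: "k (h z) = z" if "z \<in> ?T" for z
    using hom that by (simp add: homeomorphism_apply1)
  have frT: "frontier ?T \<subseteq> ?T"
    using C(2) by (simp add: frontier_subset_closed compact_imp_closed finite_imp_compact_convex_hull card_ge_0_finite)
  have "interior ?T \<noteq> {}"
    using interior_convex_hull_eq_empty[of C] C by simp
  then obtain z0 where z0: "z0 \<in> interior ?T" by blast
  have z0T: "z0 \<in> ?T" "z0 \<notin> frontier ?T"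
    using z0 interior_subset by (auto simp: frontier_def)
  have "bounded ?T"
    using C(2) by (simp add: bounded_convex_hull card_ge_0_finite finite_imp_bounded)
  then have "frontier ?T retract_of (- {z0})"
    using frontier_retract_of_punctured_universe[OF convex_convex_hull _ z0] by blast
  then obtain q where q: "retraction (- {z0}) (frontier ?T) q"
    unfolding retract_of_def by blast
  have q_cont: "continuous_on (- {z0}) q" and q_im: "q ` (- {z0}) \<subseteq> frontier ?T"
    and q_id: "\<And>z. z \<in> frontier ?T \<Longrightarrow> q z = z"
    using q unfolding retraction_def by auto
  have int: "?D \<inter> f0 \<subseteq> h ` frontier ?T"
    by (rule other_faces_Int[OF f0 C hom V E])
  \<comment> \<open>Here it matters that the surface has no boundary: every side of
    \<open>f0\<close> also lies in another face, so the retraction ends in the union of the other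
    faces.\<close>
  have frD: "h ` frontier ?T \<subseteq> ?D"
  proof -
    have "h ` (convex hull (C - {c})) \<subseteq> ?D" if "c \<in> C" for c
    proof -
      have "h ` (convex hull (C - {c})) \<in> {e \<in> E. e \<subseteq> f0}"
        unfolding E using that by blast
      then show ?thesis
        using edge_in_other_face[OF sph f0] by (metis (no_types, lifting) Union_upper mem_Collect_eq order_trans)
    qed
    then show ?thesis
      using frontier_convex_hull_cases[OF C(1)] C(2) by auto
  qed
  define x0 where "x0 = h z0"
  have x0f0: "x0 \<in> f0"
    unfolding x0_def using homeomorphism_image1[OF hom] z0T(1) by blast
  have x0D: "x0 \<notin> ?D"
  proof
    assume "x0 \<in> ?D"
    then have "x0 \<in> h ` frontier ?T" using int x0f0 by (meson IntI subsetD)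
    then obtain z where "z \<in> frontier ?T" "x0 = h z" by blast
    then show False
      using kh frT z0T unfolding x0_def by (metis subsetD)
  qed
  have S: "S - {x0} = ?D \<union> (f0 - {x0})"
    using Union_faces f0 x0D by blast
  define p where "p x = h (q (k x))" for x
  define r where "r x = (if x \<in> ?D then x else p x)" for x
  have k_ne: "k x \<noteq> z0" if "x \<in> f0 - {x0}" for x
    using that homeomorphism_apply2[OF hom, of x] unfolding x0_def by auto
  have p_fr: "p x \<in> h ` frontier ?T" if "x \<in> f0 - {x0}" for x
    unfolding p_def using q_im k_ne[OF that] by blast
  have p_id: "p x = x" if "x \<in> ?D \<inter> f0" for x
  proof -
    have "x \<in> h ` frontier ?T" using int that by (rule subsetD)
    then obtain z where z: "z \<in> frontier ?T" "x = h z" by blast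
    then have "k x = z" using kh frT by blast
    then show ?thesis using z q_id by (simp add: p_def)
  qed
  have p_cont: "continuous_on (f0 - {x0}) p"
  proof -
    have k: "continuous_on (f0 - {x0}) k"
      by (rule continuous_on_subset[OF homeomorphism_cont2[OF hom]]) blast
    have "continuous_on (f0 - {x0}) (\<lambda>x. q (k x))"
      by (rule continuous_on_compose2[OF q_cont k]) (use k_ne in auto)
    then show ?thesis
      unfolding p_def
      by (rule continuous_on_compose2[OF continuous_on_subset[OF homeomorphism_cont1[OF hom] frT]])
        (use q_im k_ne in blast)
  qed
  \<comment> \<open>Both pieces are relatively closed, and on their overlap \<open>p\<close> is the
    identity, so the two definitions paste continuously.\<close>
  have "continuous_on (?D \<union> (f0 - {x0})) r"
    unfolding r_def
  proof (rule continuous_on_cases_local[OF _ _ continuous_on_id p_cont])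
    have "closed ?D" using compact_other_faces by (rule compact_imp_closed)
    moreover have "closed f0" using compact_face f0 compact_imp_closed by blast
    moreover have "?D = (?D \<union> (f0 - {x0})) \<inter> ?D" "f0 - {x0} = (?D \<union> (f0 - {x0})) \<inter> f0"
      using x0D by blast+
    ultimately show "closedin (top_of_set (?D \<union> (f0 - {x0}))) ?D"
      "closedin (top_of_set (?D \<union> (f0 - {x0}))) (f0 - {x0})"
      by (metis closedin_closed_Int)+
    fix x assume "x \<in> ?D \<and> x \<notin> ?D \<or> x \<in> f0 - {x0} \<and> x \<in> ?D"
    then have "x \<in> ?D \<inter> f0" by blast
    from p_id[OF this] show "x = p x" by simp
  qed
  moreover have "r x \<in> ?D" if "x \<in> ?D \<union> (f0 - {x0})" for x
  proof (cases "x \<in> ?D")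
    case False
    then have "p x \<in> ?D" using p_fr[of x] frD that by (metis UnE subsetD)
    then show ?thesis using False by (simp only: r_def if_False)
  qed (simp only: r_def if_True)
  moreover have "r x = x" if "x \<in> ?D" for x
    using that by (simp only: r_def if_True)
  moreover have "x0 \<in> S" using x0f0 f0 Union_faces by blast
  ultimately show ?thesis
    using that[of x0 r] x0D unfolding S by blast
qed

subsection \<open>Monodromy on a punctured sphere\<close>

text \<open>The family \<open>g\<close> prescribes a function on the corners of each face up to a
  right factor. By \<open>compat\<close> the ratios agree along common edges, so they define a
  transport on the other faces. Its pullback to the plane has a flat section, whose values at the
  vertices form \<open>G\<close>.\<close>

lemma sphere_monodromy:
  fixes g :: "'a set \<Rightarrow> 'a \<Rightarrow> 'g::division_ring"
  assumes sph: "S homeomorphic sphere (0 :: real^3) 1" and f0: "f0 \<in> F"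
    and nz: "\<And>f x. \<lbrakk>f \<in> F - {f0}; {x} \<in> V; x \<in> f\<rbrakk> \<Longrightarrow> g f x \<noteq> 0"
    and compat: "\<And>f f' e x y. \<lbrakk>f \<in> F - {f0}; f' \<in> F - {f0}; e \<in> E; e \<subseteq> f; e \<subseteq> f';
      {x} \<in> V; {y} \<in> V; x \<in> e; y \<in> e\<rbrakk> \<Longrightarrow> g f x * inverse (g f y) = g f' x * inverse (g f' y)"
  shows "\<exists>G. \<forall>f \<in> F - {f0}. \<exists>c. c \<noteq> 0 \<and> (\<forall>x. {x} \<in> V \<longrightarrow> x \<in> f \<longrightarrow> G x = g f x * c)"
proof -
  let ?F = "F - {f0}"
  let ?D = "\<Union>?F"
  obtain x0 r where x0: "x0 \<in> S" "x0 \<notin> ?D" and r: "continuous_on (S - {x0}) r"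
    "r ` (S - {x0}) \<subseteq> ?D" "\<And>x. x \<in> ?D \<Longrightarrow> r x = x"
    using punctured_retraction[OF sph f0] by metis
  have "(S - {x0}) homeomorphic (UNIV :: (real \<times> real) set)"
    using sphere_punctured_homeomorphic_plane[OF sph x0(1), where ?'b = "real \<times> real"] by simp
  then obtain H H' where H: "homeomorphism (S - {x0}) (UNIV :: (real \<times> real) set) H H'"
    unfolding homeomorphic_def by blast
  obtain v where v: "\<And>x c. \<lbrakk>x \<in> c; c \<in> V \<union> E \<union> F\<rbrakk> \<Longrightarrow> {v x} \<in> V \<and> v x \<in> c"
    and v_vertex: "\<And>x. {x} \<in> V \<Longrightarrow> v x = x"
    using carrier_vertex_exists by blast
  \<comment> \<open>open star of \<open>x\<close>: cells around a point of \<open>N x\<close> also contain \<open>x\<close>\<close>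
  define N where "N x = - \<Union>{c \<in> V \<union> E \<union> F. x \<notin> c}" for x
  have N: "x \<in> c" if "y \<in> N x" "y \<in> c" "c \<in> V \<union> E \<union> F" for x y c
    using that unfolding N_def by blast
  have N_self: "x \<in> N x" for x
    unfolding N_def by blast
  have open_N: "open (N x)" for x
    unfolding N_def using finite_cells compact_cell compact_imp_closed
    by (intro open_Compl closed_Union) auto
  \<comment> \<open>For nearby points the choice of the face is immaterial, as \<open>t_eq\<close>
    shows. The default 1 only keeps the transport nonzero for points without a common face.\<close>
  define t where "t x y =
    (if \<exists>f \<in> ?F. x \<in> f \<and> y \<in> f
     then (let f = SOME f. f \<in> ?F \<and> x \<in> f \<and> y \<in> f in g f (v x) * inverse (g f (v y)))
     else 1)" for x y
  have gv_nz: "g f (v x) \<noteq> 0" if "f \<in> ?F" "x \<in> f" for f x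
    using nz[OF that(1), of "v x"] v[OF that(2)] that(1) by blast
  have t_some: "\<exists>f \<in> ?F. x \<in> f \<and> y \<in> f \<and> t x y = g f (v x) * inverse (g f (v y))"
    if "\<exists>f \<in> ?F. x \<in> f \<and> y \<in> f" for x y
  proof -
    let ?f = "SOME f. f \<in> ?F \<and> x \<in> f \<and> y \<in> f"
    have "?f \<in> ?F \<and> x \<in> ?f \<and> y \<in> ?f"
      by (rule someI_ex) (use that in blast)
    moreover have "t x y = g ?f (v x) * inverse (g ?f (v y))"
      using that by (simp add: t_def Let_def)
    ultimately show ?thesis by blast
  qed
  have t_nz: "t x y \<noteq> 0" for x y
  proof (cases "\<exists>f \<in> ?F. x \<in> f \<and> y \<in> f")
    case True
    from t_some[OF this] obtain f where "f \<in> ?F" "x \<in> f" "y \<in> f"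
      "t x y = g f (v x) * inverse (g f (v y))" by blast
    then show ?thesis using gv_nz by simp
  next
    case False
    then have "t x y = 1" unfolding t_def by (rule if_not_P)
    then show ?thesis by simp
  qed
  \<comment> \<open>Two faces containing \<open>y\<close> share a vertex or edge through
    \<open>y\<close>, and this cell contains \<open>x\<close> because \<open>y\<close> is in the
    star of \<open>x\<close>. On a common edge \<open>compat\<close> applies; at a common vertex
    both ratios are 1.\<close>
  have t_eq: "t x y = g f (v x) * inverse (g f (v y))" if y: "y \<in> N x" and f: "f \<in> ?F" "y \<in> f" for x y f
  proof -
    have "x \<in> f" using N y f by blast
    then have ex: "\<exists>f \<in> ?F. x \<in> f \<and> y \<in> f" using f by blast
    from t_some[OF ex] obtain f' where f': "f' \<in> ?F" "x \<in> f'" "y \<in> f'"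
      "t x y = g f' (v x) * inverse (g f' (v y))" by blast
    show ?thesis
    proof (cases "f' = f")
      case False
      then obtain c where c: "c \<in> V \<union> E" "c \<subseteq> f'" "c \<subseteq> f" "y \<in> c"
        using faces_Int[of f' f] f' f by blast
      then have xc: "x \<in> c" using N y by blast
      have vx: "{v x} \<in> V" "v x \<in> c" and vy: "{v y} \<in> V" "v y \<in> c"
        using v[OF xc] v[OF c(4)] c(1) by blast+
      show ?thesis
      proof (cases "c \<in> E")
        case True
        show ?thesis
          unfolding f'(4) by (rule compat[OF f'(1) f(1) True c(2,3) vx(1) vy(1) vx(2) vy(2)])
      next
        case False
        then have "c \<in> V" using c(1) by blast
        then have "v x = v y" using vertex_singleton vx(2) vy(2) by blast
        then show ?thesis
          unfolding f'(4) using gv_nz[OF f'(1,3)] gv_nz[OF f] by simp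
      qed
    qed (use f' in simp)
  qed
  \<comment> \<open>The plane is mapped onto the punctured sphere and then retracted to the other
    faces, where the transport is defined.\<close>
  define q where "q = r \<circ> H'"
  have q_D: "q w \<in> ?D" for w
  proof -
    have "H' w \<in> S - {x0}" using homeomorphism_image2[OF H] by (metis UNIV_I imageI)
    then have "r (H' w) \<in> ?D" by (rule subsetD[OF r(2) imageI])
    then show ?thesis by (simp only: q_def comp_apply)
  qed
  have q_cont: "continuous_on UNIV q"
    unfolding q_def
    by (rule continuous_on_compose[OF homeomorphism_cont2[OF H]])
      (simp add: homeomorphism_image2[OF H] r(1))
  have DS: "?D \<subseteq> S - {x0}" using Union_faces x0 by blast
  have qH: "q (H x) = x" if "x \<in> ?D" for x
  proof -
    have "H' (H x) = x" by (rule homeomorphism_apply1[OF H]) (rule subsetD[OF DS that])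
    then show ?thesis using r(3)[OF that] by (simp add: q_def)
  qed
  interpret local_system "\<lambda>w. q -` N (q w)" "\<lambda>w w'. t (q w) (q w')"
  proof
    fix w
    show "open (q -` N (q w))"
      using open_vimage[OF open_N q_cont] .
    show "w \<in> q -` N (q w)" using N_self by simp
    fix w' show "t (q w) (q w') \<noteq> 0" by (rule t_nz)
    fix w''
    assume "w' \<in> q -` N (q w)" "w'' \<in> q -` N (q w)" "w'' \<in> q -` N (q w')"
    then have n: "q w' \<in> N (q w)" "q w'' \<in> N (q w)" "q w'' \<in> N (q w')" by auto
    \<comment> \<open>A single face around the last point contains the other two as well, and
      computes all three transports.\<close>
    obtain f where f: "f \<in> ?F" "q w'' \<in> f" using q_D[of w''] by blast
    then have f': "q w' \<in> f" using N n(3) by blast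
    show "t (q w) (q w'') = t (q w) (q w') * t (q w') (q w'')"
      unfolding t_eq[OF n(1) f(1) f'] t_eq[OF n(2) f] t_eq[OF n(3) f]
      using gv_nz[OF f(1) f'] by (simp add: mult.assoc flip: mult.assoc[of "inverse (g f (v (q w')))"])
  qed
  have D_cont: "continuous_on ?D H"
    by (rule continuous_on_subset[OF homeomorphism_cont1[OF H] DS])
  then have "compact (H ` ?D)"
    by (rule compact_continuous_image) (rule compact_other_faces)
  \<comment> \<open>The image of the other faces is compact, so a section on one large rectangle
    suffices.\<close>
  then obtain b where b: "b > 0" "\<And>w. w \<in> H ` ?D \<Longrightarrow> norm w \<le> b"
    using compact_imp_bounded bounded_pos by metis
  let ?R = "{-b..b} \<times> {-b..b}"
  have HR: "H x \<in> ?R" if "x \<in> ?D" for x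
  proof -
    have "norm (fst (H x)) \<le> b" "norm (snd (H x)) \<le> b"
      using b(2)[of "H x"] that norm_fst_le[of "fst (H x)" "snd (H x)"]
        norm_snd_le[of "snd (H x)" "fst (H x)"] by (auto intro: order_trans)
    then show ?thesis by (auto simp: mem_Times_iff)
  qed
  obtain s where s: "flat_section ?R s"
    using flat_section_rectangle[OF local_system_axioms, of "-b" b "-b" b] b(1) by auto
  show ?thesis
  proof (intro exI[of _ "\<lambda>x. s (H x)"] ballI)
    fix f assume f: "f \<in> ?F"
    then have fD: "f \<subseteq> ?D" by blast
    \<comment> \<open>The quotient of the section by \<open>g f\<close> is locally constant on the
      connected face \<open>f\<close>; its value is the right factor sought.\<close>
    define u where "u x = inverse (g f (v x)) * s (H x)" for x
    obtain a where a: "a \<in> f" using face_has_vertex f by blast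
    have const: "u a = u x" if "x \<in> f" for x
    proof (rule connected_local_const[OF connected_face a that], safe)
      show "f \<in> F" using f by blast
      fix y assume y: "y \<in> f"
      have "\<forall>\<^sub>F w in nhds (H y). w \<in> ?R \<longrightarrow> s (H y) = t (q (H y)) (q w) * s w"
        using s HR y fD unfolding flat_section_def by blast
      moreover have "filterlim H (nhds (H y)) (at y within f)"
        using continuous_on_subset[OF D_cont fD] y unfolding continuous_on_def by blast
      ultimately have "\<forall>\<^sub>F z in at y within f. H z \<in> ?R \<longrightarrow> s (H y) = t (q (H y)) (q (H z)) * s (H z)"
        by (rule eventually_compose_filterlim)
      moreover have "\<forall>\<^sub>F z in at y within f. z \<in> N y"
        using open_N N_self by (meson eventually_at_topological)
      moreover have "\<forall>\<^sub>F z in at y within f. z \<in> f"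
        by (simp add: eventually_at_filter)
      ultimately show "\<forall>\<^sub>F z in at y within f. u y = u z"
      proof eventually_elim
        case (elim z)
        then have "z \<in> ?D" "y \<in> ?D" using fD y by blast+
        then have "s (H y) = t y z * s (H z)"
          using elim(1) HR[of z] qH by simp
        also have "t y z = g f (v y) * inverse (g f (v z))"
          using t_eq elim(2,3) f by blast
        finally show "u y = u z"
          unfolding u_def using gv_nz[OF f y] by (simp flip: mult.assoc)
      qed
    qed
    have "u a \<noteq> 0"
    proof -
      have "H a \<in> ?R" by (rule HR[OF subsetD[OF fD a]])
      then have "s (H a) \<noteq> 0" using s[unfolded flat_section_def] by (metis (lifting))
      then show ?thesis using gv_nz[OF f a] by (simp add: u_def)
    qed
    moreover have "s (H x) = g f x * u a" if "{x} \<in> V" "x \<in> f" for x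
      using const[OF that(2)] gv_nz[OF f that(2)] unfolding v_vertex[OF that(1)] u_def
      by (simp add: v_vertex[OF that(1)] flip: mult.assoc)
    ultimately show "\<exists>c. c \<noteq> 0 \<and> (\<forall>x. {x} \<in> V \<longrightarrow> x \<in> f \<longrightarrow> s (H x) = g f x * c)"
      by blast
  qed
qed

end

subsection \<open>Elementary proofs on the sphere\<close>

lemma elementary_sphere_tiling_sound:
  fixes S :: "'a::euclidean_space set" and u w :: "nat \<Rightarrow> 'g::division_ring \<times> 'g \<times> 'g"
  assumes sph: "S homeomorphic sphere (0 :: real^3) 1"
    and "elementary_tiling_proof S M" and real: "realizes M u w"
  shows "pairing (u 0) (w 0) = 0"
proof -
  obtain V E F p l where tri: "triangulation_of S V E F"
    and p: "p ` (V \<union> E) \<subseteq> {..<dim_row M}" and l: "l ` (F \<union> E) \<subseteq> {..<dim_col M}"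
    and ex1: "\<exists>!(i, j). i \<in> E \<and> j \<in> F \<and> i \<subseteq> j \<and> p i = 0 \<and> l j = 0"
    and pos_face: "\<forall>i \<in> E. \<forall>j \<in> F. i \<subseteq> j \<and> \<not> (p i = 0 \<and> l j = 0) \<longrightarrow> M $$ (p i, l j) = 1"
    and pos_edge: "\<forall>i \<in> V \<union> E. \<forall>j \<in> E. i \<subseteq> j \<longrightarrow> M $$ (p i, l j) = 1"
    and neg: "\<forall>i \<in> V \<union> E. \<forall>j \<in> E. (\<exists>f \<in> F. i \<subseteq> f \<and> j \<subseteq> f) \<and> \<not> i \<subseteq> j \<longrightarrow> M $$ (p i, l j) = -1"
    using assms(2) unfolding elementary_tiling_proof_def by (elim exE conjE) (rule that; assumption)
  interpret triangulated S V E F by unfold_locales fact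
  define U where "U x = u (p {x})" for x
  have w_nz: "w (l j) \<noteq> 0" if "j \<in> F \<union> E" for j
    using real l that unfolding realizes_def by blast
  have inc: "pairing (u (p i)) (w (l j)) = 0" if "M $$ (p i, l j) = 1" "i \<in> V \<union> E" "j \<in> F \<union> E" for i j
    using real p l that unfolding realizes_def by blast
  have ninc: "pairing (u (p i)) (w (l j)) \<noteq> 0" if "M $$ (p i, l j) = -1" "i \<in> V \<union> E" "j \<in> F \<union> E" for i j
    using real p l that unfolding realizes_def by blast
  from ex1 obtain e0 f0 where e0: "e0 \<in> E" "f0 \<in> F" "e0 \<subseteq> f0" "p e0 = 0" "l f0 = 0"
    by blast
  have unique: "e = e0 \<and> f = f0" if "e \<in> E" "f \<in> F" "e \<subseteq> f" "p e = 0" "l f = 0" for e f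
  proof -
    have "(e, f) = (e0, f0)"
      using ex1 that e0 by (elim ex1E) (metis (mono_tags, lifting) case_prodI)
    then show ?thesis by simp
  qed
  have on_face: "pairing (u (p e)) (w (l f)) = 0" if "e \<in> E" "f \<in> F" "e \<subseteq> f" "(e, f) \<noteq> (e0, f0)" for e f
  proof -
    have "\<not> (p e = 0 \<and> l f = 0)"
      using unique[OF that(1-3)] that(4) by auto
    then have "M $$ (p e, l f) = 1"
      using pos_face that(1-3) by blast
    then show ?thesis
      by (rule inc) (use that in auto)
  qed
  \<comment> \<open>In every face, \<open>f0\<close> included, the lines of the sides form a dual
    basis for the corner vectors, up to nonzero scalars. The point of a side lies on the line of
    that side only.\<close>
  have frame: "pairing (U x) (w (l (op y))) = 0 \<longleftrightarrow> x \<noteq> y"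
    "pairing (u (p (op x))) (w (l (op y))) = 0 \<longleftrightarrow> x = y"
    if fr: "face_frame f K op" and f: "f \<in> F" and xy: "x \<in> K" "y \<in> K" for f K op x y
  proof -
    note K = face_frameD[OF fr]
    have V: "{z} \<in> V" "{z} \<subseteq> f" if "z \<in> K" for z
      using K(2) that by blast+
    have E: "op z \<in> E" "op z \<subseteq> f" if "z \<in> K" for z
      using K(3) that by blast+
    have mem: "{z} \<subseteq> op z' \<longleftrightarrow> z \<noteq> z'" if "z \<in> K" "z' \<in> K" for z z'
      using K(4) that by blast
    show "pairing (U x) (w (l (op y))) = 0 \<longleftrightarrow> x \<noteq> y"
    proof (cases "x = y")
      case True
      then have "M $$ (p {x}, l (op y)) = -1"
        using neg V[OF xy(1)] E[OF xy(2)] mem[OF xy] f by blast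
      then show ?thesis
        using ninc V[OF xy(1)] E[OF xy(2)] True unfolding U_def by blast
    next
      case False
      then have "M $$ (p {x}, l (op y)) = 1"
        using pos_edge V[OF xy(1)] E[OF xy(2)] mem[OF xy] by blast
      then show ?thesis
        using inc V[OF xy(1)] E[OF xy(2)] False unfolding U_def by blast
    qed
    show "pairing (u (p (op x))) (w (l (op y))) = 0 \<longleftrightarrow> x = y"
    proof (cases "x = y")
      case True
      then have "M $$ (p (op x), l (op y)) = 1"
        using pos_edge E[OF xy(2)] by blast
      then show ?thesis
        using inc E[OF xy(1)] E[OF xy(2)] True by blast
    next
      case False
      then have "\<not> op x \<subseteq> op y"
        using mem[OF xy(2,1)] mem[OF xy(2,2)] by blast
      then have "M $$ (p (op x), l (op y)) = -1"
        using neg E[OF xy(1)] E[OF xy(2)] f by blast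
      then show ?thesis
        using ninc E[OF xy(1)] E[OF xy(2)] False by blast
    qed
  qed
  \<comment> \<open>Here \<open>point_on_side\<close> turns the incidences and nonincidences of a
    side into coordinates relative to its end points.\<close>
  have side: "\<exists>s t. s \<noteq> 0 \<and> t \<noteq> 0 \<and> u (p (op c)) = lscale s (U a) + lscale t (U b)"
    if "face_frame f K op" "f \<in> F" "K = {a, b, c}" "a \<noteq> b" "a \<noteq> c" "b \<noteq> c" for f K op a b c
  proof -
    note fr = frame[OF that(1,2)]
    have "a \<in> K" "b \<in> K" "c \<in> K" using that(3) by auto
    then show ?thesis
      using point_on_side[of "U a" "w (l (op a))" "U b" "U c" "w (l (op b))" "w (l (op c))" "u (p (op c))"]
      using fr(1) fr(2) that(4-6) by metis
  qed
  have third: "\<exists>c. K = {a, b, c} \<and> a \<noteq> c \<and> b \<noteq> c" if "card K = 3" "a \<in> K" "b \<in> K" "a \<noteq> b"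
    for K and a b :: 'a
  proof -
    have "card (K - {a, b}) = 1"
      using that by (simp add: card_Diff_subset card_ge_0_finite)
    then obtain c where "K - {a, b} = {c}" by (auto simp: card_1_singleton_iff)
    then show ?thesis using that by blast
  qed
  \<comment> \<open>The value at the vertex \<open>x\<close> of the functional attached to
    \<open>f\<close>.\<close>
  define g where "g f x = pairing (U x) (w (l f))" for f x
  have edge_rel: "\<exists>s t. s \<noteq> 0 \<and> t \<noteq> 0 \<and> u (p e) = lscale s (U x) + lscale t (U y)"
    if e: "e \<in> E" and x: "{x} \<in> V" "x \<in> e" and y: "{y} \<in> V" "y \<in> e" and "x \<noteq> y" for e x y
  proof -
    obtain f where f: "f \<in> F" "e \<subseteq> f" using cell_in_face e by blast
    obtain K op where fr: "face_frame f K op" using face_frame_exists[OF f(1)] .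
    note K = face_frameD[OF fr]
    have xy: "x \<in> K" "y \<in> K"
      using K(2) x y f(2) by blast+
    obtain c' where c': "c' \<in> K" "e = op c'" using K(3) e f(2) by blast
    obtain c where c: "K = {x, y, c}" "x \<noteq> c" "y \<noteq> c" using third[OF K(1) xy \<open>x \<noteq> y\<close>] by blast
    have "x \<noteq> c'" "y \<noteq> c'" using K(4)[OF c'(1)] x y xy c'(2) by blast+
    then have "c' = c" using c'(1) c(1) by blast
    then show ?thesis
      using side[OF fr f(1) c(1) \<open>x \<noteq> y\<close> c(2,3)] c'(2) by blast
  qed
  have g_rel: "s * g f x + t * g f y = 0"
    if "e \<in> E" "f \<in> F" "e \<subseteq> f" "(e, f) \<noteq> (e0, f0)" "u (p e) = lscale s (U x) + lscale t (U y)" for e f x y s t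
    using on_face[OF that(1-4)] unfolding that(5) g_def by simp
  have rel_zero: "g f y = 0"
    if "f \<in> F - {f0}" "e \<in> E" "e \<subseteq> f" "{x} \<in> V" "x \<in> e" "{y} \<in> V" "y \<in> e" "x \<noteq> y" "g f x = 0" for f e x y
  proof -
    from edge_rel[OF that(2,4-8)]
    obtain s t where st: "s \<noteq> 0" "t \<noteq> 0" "u (p e) = lscale s (U x) + lscale t (U y)"
      by blast
    show ?thesis
      using g_rel[OF that(2) _ that(3) _ st(3)] that(1,9) st(2) by auto
  qed
  \<comment> \<open>A zero at one corner would spread along the edges of \<open>f\<close> to all
    corners. The corner vectors span the space, so the functional itself would vanish.\<close>
  have g_nz: "g f x \<noteq> 0" if f: "f \<in> F - {f0}" and x: "{x} \<in> V" "x \<in> f" for f x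
  proof
    assume 0: "g f x = 0"
    have fF: "f \<in> F" using f by blast
    obtain K op where fr: "face_frame f K op" using face_frame_exists[OF fF] .
    note K = face_frameD[OF fr]
    have xK: "x \<in> K" using K(2) x by blast
    have all: "g f y = 0" if y: "y \<in> K" for y
    proof (cases "y = x")
      case False
      obtain c where c: "K = {x, y, c}" "x \<noteq> c" "y \<noteq> c" using third[OF K(1) xK y] False by blast
      then have "c \<in> K" by blast
      have V: "{x} \<in> V" "{y} \<in> V" "op c \<in> E" "op c \<subseteq> f" using K(2,3) xK y \<open>c \<in> K\<close> by blast+
      have "x \<in> op c" "y \<in> op c" using K(4)[OF \<open>c \<in> K\<close>] c xK y by blast+
      then show ?thesis
        using rel_zero[OF f V(3,4,1) _ V(2)] 0 False by blast
    qed (use 0 in simp)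
    have "card (K - {x}) = 2" using K(1) xK by simp
    then have "K - {x} \<noteq> {}" by (metis card.empty zero_neq_numeral)
    then obtain y where y: "y \<in> K" "x \<noteq> y" by blast
    obtain c where c: "K = {x, y, c}" "x \<noteq> c" "y \<noteq> c" using third[OF K(1) xK y] by blast
    have "pairing W (w (l f)) = 0" for W
    proof -
      have mem: "x \<in> K" "y \<in> K" "c \<in> K" using c by auto
      note fr' = frame(1)[OF fr fF]
      obtain s t z where "W = lscale s (U x) + lscale t (U y) + lscale z (U c)"
        by (rule dual_basis_span[of "U x" "w (l (op x))" "U y" "U c" "w (l (op y))" "w (l (op c))" W])
          (use mem y(2) c(2,3) in \<open>simp_all add: fr'\<close>)
      then show ?thesis using all[OF mem(1)] all[OF mem(2)] all[OF mem(3)] by (simp add: g_def)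
    qed
    then have "w (l f) = 0" by (rule pairing_eq_0_all)
    then show False using w_nz fF by blast
  qed
  \<comment> \<open>The right-hand side depends only on the point of the edge and not on the face,
    which gives the compatibility of neighbouring faces.\<close>
  have ratio: "g f x * inverse (g f y) = - (inverse s * t)"
    if "f \<in> F - {f0}" "e \<in> E" "e \<subseteq> f" "{y} \<in> V" "y \<in> e" "s \<noteq> 0"
      "u (p e) = lscale s (U x) + lscale t (U y)" for f e x y s t
  proof -
    have "s * g f x + t * g f y = 0"
      using g_rel[OF that(2) _ that(3) _ that(7)] that(1) by blast
    then have "s * g f x = - (t * g f y)" by (simp add: eq_neg_iff_add_eq_0)
    then have "inverse s * (s * g f x) = inverse s * - (t * g f y)" by simp
    then have "g f x = - (inverse s * t) * g f y"
      using that(6) by (simp add: mult.assoc flip: mult.assoc[of "inverse s" s])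
    moreover have "g f y \<noteq> 0"
      by (rule g_nz) (use that in blast)+
    ultimately show ?thesis by (simp add: mult.assoc)
  qed
  have compat: "g f x * inverse (g f y) = g f' x * inverse (g f' y)"
    if "f \<in> F - {f0}" "f' \<in> F - {f0}" "e \<in> E" "e \<subseteq> f" "e \<subseteq> f'"
      "{x} \<in> V" "{y} \<in> V" "x \<in> e" "y \<in> e" for f f' e x y
  proof (cases "x = y")
    case True
    then show ?thesis
      using g_nz[of f x] g_nz[of f' x] that by (metis right_inverse subsetD)
  next
    case False
    from edge_rel[OF that(3,6,8,7,9) False]
    obtain s t where st: "s \<noteq> 0" "t \<noteq> 0" "u (p e) = lscale s (U x) + lscale t (U y)"
      by blast
    show ?thesis
      using ratio[OF that(1,3,4,7,9) st(1,3)] ratio[OF that(2,3,5,7,9) st(1,3)] by simp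
  qed
  have "\<exists>G. \<forall>f \<in> F - {f0}. \<exists>c. c \<noteq> 0 \<and> (\<forall>x. {x} \<in> V \<longrightarrow> x \<in> f \<longrightarrow> G x = g f x * c)"
    by (rule sphere_monodromy[OF sph e0(2)]) (fact g_nz, rule compat)
  then obtain G where G: "\<And>f. f \<in> F - {f0} \<Longrightarrow>
      \<exists>c. c \<noteq> 0 \<and> (\<forall>x. {x} \<in> V \<longrightarrow> x \<in> f \<longrightarrow> G x = g f x * c)"
    by (elim exE) (rule that, erule bspec)
  \<comment> \<open>The relation on an edge of \<open>f0\<close> is borrowed from a face on the
    other side. That face differs from \<open>f0\<close>, so its incidence with the edge is among
    the hypotheses, even for \<open>e0\<close>.\<close>
  have G_rel: "s * G x + t * G y = 0" "G x \<noteq> 0"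
    if e: "e \<in> E" "e \<subseteq> f0" and x: "{x} \<in> V" "x \<in> e" and y: "{y} \<in> V" "y \<in> e"
      and st: "u (p e) = lscale s (U x) + lscale t (U y)" for e x y s t
  proof -
    obtain f where f: "f \<in> F - {f0}" "e \<subseteq> f"
      using edge_in_other_face[OF sph e0(2) e] .
    obtain c where c: "c \<noteq> 0" "\<forall>x. {x} \<in> V \<longrightarrow> x \<in> f \<longrightarrow> G x = g f x * c"
      using G[OF f(1)] by blast
    have "G x = g f x * c" "G y = g f y * c"
      using c(2) x y f(2) by blast+
    moreover have "s * g f x + t * g f y = 0"
      using g_rel[OF e(1) _ f(2) _ st] f(1) by blast
    ultimately show "s * G x + t * G y = 0"
      by (metis distrib_right mult.assoc mult_zero_left)
    show "G x \<noteq> 0"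
      using \<open>G x = _\<close> c(1) g_nz[OF f(1) x(1)] x(2) f(2) by auto
  qed
  obtain K op where fr: "face_frame f0 K op" using face_frame_exists[OF e0(2)] .
  note K = face_frameD[OF fr]
  obtain c where c: "c \<in> K" "e0 = op c" using K(3) e0 by blast
  have "card (K - {c}) = 2" using K(1) c by simp
  then obtain a b where ab: "K - {c} = {a, b}" "a \<noteq> b"
    by (auto simp: card_2_iff)
  then have abc: "K = {a, b, c}" "K = {b, c, a}" "K = {a, c, b}" "a \<noteq> c" "b \<noteq> c" "c \<noteq> a" "c \<noteq> b"
    using c by auto
  have mem: "a \<in> K" "b \<in> K" "c \<in> K" using abc by auto
  have V: "{x} \<in> V" "op x \<in> E" "op x \<subseteq> f0" if "x \<in> K" for x
    using K(2,3) that by blast+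
  have in_op: "x \<in> op y" if "x \<in> K" "y \<in> K" "x \<noteq> y" for x y
    using K(4)[OF that(2)] that by blast
  \<comment> \<open>The exceptional edge is the one opposite \<open>c\<close>, so the other two
    sides of \<open>f0\<close> have ordinary incidences.\<close>
  have op_ne: "(op x, f0) \<noteq> (e0, f0)" if "x \<in> {a, b}" for x
    using that c(2) in_op[of c x] K(4)[OF c(1)] mem abc(4-7) by blast
  obtain s1 t1 where a1: "s1 \<noteq> 0" "u (p (op b)) = lscale s1 (U a) + lscale t1 (U c)"
    using side[OF fr e0(2) abc(3,4) ab(2) abc(7)] by blast
  obtain s2 t2 where a2: "s2 \<noteq> 0" "u (p (op a)) = lscale s2 (U b) + lscale t2 (U c)"
    using side[OF fr e0(2) abc(2,5) ab(2)[symmetric] abc(6)] by blast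
  obtain s3 t3 where a3: "s3 \<noteq> 0" "u (p (op c)) = lscale s3 (U a) + lscale t3 (U b)"
    using side[OF fr e0(2) abc(1) ab(2) abc(4,5)] by blast
  have Gc: "G c \<noteq> 0"
  proof -
    obtain s t where "u (p (op a)) = lscale s (U c) + lscale t (U b)"
      using edge_rel[OF V(2)[OF mem(1)] V(1)[OF mem(3)] in_op[OF mem(3,1) abc(6)]
        V(1)[OF mem(2)] in_op[OF mem(2,1) ab(2)[symmetric]] abc(7)] by blast
    then show ?thesis
      by (rule G_rel(2)[OF V(2,3)[OF mem(1)] V(1)[OF mem(3)] in_op[OF mem(3,1) abc(6)]
        V(1)[OF mem(2)] in_op[OF mem(2,1) ab(2)[symmetric]]])
  qed
  \<comment> \<open>The factor between \<open>g f0\<close> and \<open>G\<close> is read off at the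
    corner \<open>c\<close>, which lies on both ordinary sides; these carry it to \<open>a\<close>
    and \<open>b\<close>. It may be zero.\<close>
  define k where "k = inverse (G c) * g f0 c"
  have gc: "g f0 c = G c * k"
    using Gc by (simp add: k_def flip: mult.assoc)
  have proportional: "g f0 x = G x * k" if "s \<noteq> 0" "s * g f0 x + t * g f0 c = 0" "s * G x + t * G c = 0" for s t x
  proof -
    have "s * (G x * k) + t * g f0 c = 0"
      using that(3) unfolding gc by (metis distrib_right mult.assoc mult_zero_left)
    then have "s * g f0 x = s * (G x * k)"
      using that(2) by (metis add_right_cancel)
    then show ?thesis using that(1) by simp
  qed
  have ga: "g f0 a = G a * k"
    by (rule proportional[OF a1(1) g_rel[OF V(2)[OF mem(2)] e0(2) V(3)[OF mem(2)] op_ne a1(2)]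
        G_rel(1)[OF V(2,3)[OF mem(2)] V(1)[OF mem(1)] in_op[OF mem(1,2) ab(2)]
          V(1)[OF mem(3)] in_op[OF mem(3,2) abc(7)] a1(2)]]) simp
  have gb: "g f0 b = G b * k"
    by (rule proportional[OF a2(1) g_rel[OF V(2)[OF mem(1)] e0(2) V(3)[OF mem(1)] op_ne a2(2)]
        G_rel(1)[OF V(2,3)[OF mem(1)] V(1)[OF mem(2)] in_op[OF mem(2,1) ab(2)[symmetric]]
          V(1)[OF mem(3)] in_op[OF mem(3,1) abc(6)] a2(2)]]) simp
  \<comment> \<open>For the exceptional edge the relation is known for \<open>G\<close>; multiplying
    by \<open>k\<close> on the right gives it for \<open>g f0\<close>, which is the missing
    incidence.\<close>
  have "s3 * G a + t3 * G b = 0"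
    by (rule G_rel(1)[OF V(2,3)[OF mem(3)] V(1)[OF mem(1)] in_op[OF mem(1,3) abc(4)]
          V(1)[OF mem(2)] in_op[OF mem(2,3) abc(5)] a3(2)])
  then have "s3 * g f0 a + t3 * g f0 b = 0"
    unfolding ga gb by (metis distrib_right mult.assoc mult_zero_left)
  then have "pairing (u (p (op c))) (w (l f0)) = 0"
    unfolding a3(2) by (simp add: g_def)
  then show ?thesis
    using c(2) e0(4,5) by simp
qed

theorem theorem5p1:
  fixes M :: "int mat"
  assumes "incidence_matrix M"
    and "sphere_tiling_proof M"
  shows "incidence_theorem_true_over TYPE('a::division_ring) M"
proof -
  have dims: "0 < dim_row M" "0 < dim_col M"
    using assms(1) unfolding incidence_matrix_def by auto
  show ?thesis
    unfolding incidence_theorem_true_over_iff[OF dims]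
  proof (intro allI impI)
    fix u w :: "nat \<Rightarrow> 'a \<times> 'a \<times> 'a"
    assume "realizes M u w"
    \<comment> \<open>Constant Laurent series preserve vanishing and nonvanishing of the pairing, so
      the conclusion can be carried back to the original skew field.\<close>
    then have "realizes M (\<lambda>i. fls_const3 (u i)) (\<lambda>j. fls_const3 (w j))"
      by (rule realizes_fls_const3)
    from tiling_proof_sound[OF infinite_fls _ assms(2)[unfolded sphere_tiling_proof_def] this dims]
    have "pairing (fls_const3 (u 0)) (fls_const3 (w 0)) = 0"
      using elementary_sphere_tiling_sound by blast
    then show "pairing (u 0) (w 0) = 0"
      by (simp add: pairing_fls_const3)
  qed
qed

end
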